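(* Let $w:\mathbb{R}\to(0,\infty)$. For each $x\in\mathbb{R}$ define $g_x:\mathbb{R}\to(0,\infty)$ by $g_x(y)=w(y+x)/w(y)$. Then $\|(\tau_xf-f)w\|\to 0$ as $x\to 0$ for all $f:\mathbb{R}\to\mathbb{R}$ such that $fw\in\mathcal{HK}$ if and only if $g_x$ is essentially bounded and of essential bounded variation, uniformly as $x\to 0$, and $g_x\to 1$ in measure on compact intervals as $x\to 0$.
   Context: $\mathcal{HK}$ denotes the set of functions $f:\mathbb{R}\to\mathbb{R}$ that are Henstock--Kurzweil integrable on the whole real line. The Alexiewicz norm of $h\in\mathcal{HK}$ is $\|h\|=\sup_I\left|\int_I h\right|$, where the supremum is over all intervals $I\subset\mathbb{R}$ (bounded or unbounded). Functions equal almost everywhere are identified. For $x,y\in\mathbb{R}$, $\tau_xf(y)=f(y-x)$. The assertion "$\|(\tau_xf-f)w\|\to0$ as $x\to0$" includes that $(\tau_xf-f)w\in\mathcal{HK}$ for all $x$ sufficiently close to $0$. The essential variation of a function $g$ on $\mathbb{R}$ is the infimum of the total variations over $\mathbb{R}$ of all functions equal to $g$ almost everywhere. "$g_x$ is essentially bounded and of essential bounded variation, uniformly as $x\to0$" means: there are $\delta>0$ and $M<\infty$ such that for all $|x|<\delta$ the essential supremum of $|g_x|$ over $\mathbb{R}$ and the essential variation of $g_x$ over $\mathbb{R}$ are both at most $M$. "$g_x\to1$ in measure on compact intervals as $x\to0$" means: for each compact interval $I\subset\mathbb{R}$ and each $\epsilon>0$, $\lambda(\{y\in I: |g_x(y)-1|>\epsilon\})\to0$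 as $x\to0$, where $\lambda$ is Lebesgue measure. *)

theory Defs
  imports "HOL-Analysis.Analysis" "HOL-Probability.Essential_Supremum"
begin

(* The gauge integral over UNIV is the Henstock-Kurzweil integral on the whole line. Integrability
   and integrals are unaffected by changes on null sets, so functions represent their classes. *)
definition HK :: "(real \<Rightarrow> real) set" where
  "HK = {h. h integrable_on UNIV}"

(* Extended-real valued, so that no boundedness is presupposed. It is meaningful only for h in HK:
   otherwise integrals that do not exist take the default value 0. *)
definition alexiewicz_norm :: "(real \<Rightarrow> real) \<Rightarrow> ereal" where
  "alexiewicz_norm h = (SUP I\<in>{I. is_interval I}. ereal \<bar>integral I h\<bar>)"

definition translate :: "real \<Rightarrow> (real \<Rightarrow> real) \<Rightarrow> real \<Rightarrow> real" where
  "translate x f = (\<lambda>y. f (y - x))"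

definition alexiewicz_tendsto_0 :: "(real \<Rightarrow> real \<Rightarrow> real) \<Rightarrow> bool" where
  "alexiewicz_tendsto_0 h \<longleftrightarrow>
     (\<forall>\<^sub>F x in at 0. h x \<in> HK) \<and> ((\<lambda>x. alexiewicz_norm (h x)) \<longlongrightarrow> 0) (at 0)"

definition total_variation :: "(real \<Rightarrow> real) \<Rightarrow> ereal" where
  "total_variation h =
     (SUP (n, p)\<in>{(n :: nat, p :: nat \<Rightarrow> real). \<forall>i<n. p i \<le> p (Suc i)}.
        \<Sum>i<n. ereal \<bar>h (p (Suc i)) - h (p i)\<bar>)"

definition essential_variation :: "(real \<Rightarrow> real) \<Rightarrow> ereal" where
  "essential_variation g =
     (INF h\<in>{h. AE y in lebesgue. h y = g y}. total_variation h)"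

(* esssup is top for functions that are not measurable. This excludes nothing here: a function of
   finite essential variation is Lebesgue measurable. *)
definition unif_ess_bounded_ess_bv :: "(real \<Rightarrow> real \<Rightarrow> real) \<Rightarrow> bool" where
  "unif_ess_bounded_ess_bv g \<longleftrightarrow>
     (\<exists>\<delta>>0. \<exists>M :: real. \<forall>x. \<bar>x\<bar> < \<delta> \<longrightarrow>
        esssup lebesgue (\<lambda>y. ereal \<bar>g x y\<bar>) \<le> ereal M \<and> essential_variation (g x) \<le> ereal M)"

(* emeasure is 0 on sets that are not measurable, so this is to be used for families g
   with g x Lebesgue measurable for all small x. *)
definition tendsto_1_in_measure_on_compacts :: "(real \<Rightarrow> real \<Rightarrow> real) \<Rightarrow> bool" where
  "tendsto_1_in_measure_on_compacts g \<longleftrightarrow>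
     (\<forall>a b. \<forall>\<epsilon>>0.
        ((\<lambda>x. emeasure lebesgue {y \<in> {a..b}. \<bar>g x y - 1\<bar> > \<epsilon>}) \<longlongrightarrow> 0) (at 0))"

end

theory Submission
  imports Defs
begin

text \<open>
  Write h = f w. Then (tau_x f - f) w = tau_x (h g_x) - h, and h is an arbitrary element of HK,
  because w has no zeros. Translation is continuous on HK, so the left-hand side of the theorem says that
  multiplication by g_x converges strongly to the identity: for each h in HK, h g_x is in HK for small x,
  and the norm of h (g_x - 1) tends to 0 (lemma \<open>alexiewicz_tendsto_0_translate_iff\<close>). The norm is the
  supremum of the integrals over compact intervals (\<open>alexiewicz_norm_le_iff\<close>), and membership in HK is
  integrability on compact intervals together with a Cauchy condition at infinity
  (\<open>HK_iff_Cauchy_tails\<close>).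

  A function has finite essential supremum and finite essential variation if and only if it is almost
  everywhere a difference of two bounded monotone functions, and the bounds control each other. In this form
  (\<open>ess_mono_diff\<close>) it is a multiplier of HK: by the second mean value theorem, multiplication by it
  increases the norm by a factor of at most 4 M, where M bounds the monotone parts
  (\<open>ess_mono_diff_multiplier\<close>).

  Sufficiency of the two conditions follows by density. With uniformly bounded multipliers it is enough to
  prove convergence on a dense set. Bounded functions s of bounded support are dense
  (\<open>HK_approx_bounded\<close>), and the norm of s (g_x - 1) is at most a constant times the integral of
  \<bar>g_x - 1\<bar> over a compact interval. That integral tends to 0 by boundedness and convergence in measure.

  The main part of the necessity is a uniform bound for the functionals s \<mapsto> \<integral> s g_x on test functions s of
  norm at most 1. The space HK is not complete, and the range of x for which h g_x is in HK depends on h, so the uniform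
  boundedness principle for Banach spaces does not apply. A gliding hump argument replaces it (\<open>gliding_hump\<close>).
  If the functionals were not uniformly bounded near some point, or near one of the two infinities, then there would be test functions s_k with disjoint supports converging
  to that place and points x_k \<rightarrow> 0 for which \<bar>\<integral> s_k g_{x_k}\<bar> exceeds 4 * 2^k. The sum of the functions s_k / 2^k
  belongs to HK, since its primitive is a uniformly convergent series which is differentiable off one point.
  It violates the convergence on the interval that carries s_k. Finitely many of the neighbourhoods so obtained
  cover the extended line (\<open>uniformly_bounded_on_UNIV\<close>). The uniform bound is then tested on signed
  differences of normalised indicator functions of short intervals that start at Lebesgue points of g_x, and this
  yields the bound for the variation (\<open>ess_mono_diff_by_duality\<close>).

  Convergence in measure is a second use of the multiplier inequality, with u = g_x - 1 in both roles: the integral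
  of u * u over [a, b] is at most a constant times the norm of u on [a, b], and this tends to 0.
\<close>

section \<open>Primitives and the Alexiewicz norm\<close>

text \<open>
  At infinity there is nothing improper about the gauge integral: an integral over the line is a limit of integrals
  over compact intervals, so that the existence of this limit is all that has to be added.
\<close>

lemma HK_iff_Cauchy_tails:
  "h \<in> HK \<longleftrightarrow> (\<forall>a b. h integrable_on {a..b}) \<and>
    (\<forall>\<epsilon>>0. \<exists>B. \<forall>u v. u \<le> v \<and> (B \<le> u \<or> v \<le> - B) \<longrightarrow> \<bar>integral {u..v} h\<bar> \<le> \<epsilon>)"
  (is "_ \<longleftrightarrow> ?int \<and> ?tails")
proof (intro iffI conjI)
  assume "h \<in> HK"
  then have "h integrable_on UNIV" by (simp add: HK_def)
  then have alt: "\<And>a b. h integrable_on {a..b}"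
      "\<And>e. e > 0 \<Longrightarrow> \<exists>B>0. \<forall>a b c d. ball 0 B \<subseteq> {a..b} \<and> ball 0 B \<subseteq> {c..d} \<longrightarrow>
        \<bar>integral {a..b} h - integral {c..d} h\<bar> < e"
    unfolding integrable_alt[of h UNIV] by simp_all
  show ?int using alt(1) by blast
  show ?tails
  proof (intro allI impI)
    fix \<epsilon> :: real assume "\<epsilon> > 0"
    then obtain B where "B > 0" and B: "\<And>a b c d. ball 0 B \<subseteq> {a..b} \<Longrightarrow> ball 0 B \<subseteq> {c..d} \<Longrightarrow>
        \<bar>integral {a..b} h - integral {c..d} h\<bar> < \<epsilon>"
      using alt(2) by metis
    have b: "ball 0 B \<subseteq> {a..b}" if "a \<le> -B" "B \<le> b" for a b :: real
      using that by (auto simp: dist_real_def)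
    have "\<bar>integral {u..v} h\<bar> \<le> \<epsilon>" if "u \<le> v" "B \<le> u \<or> v \<le> - B" for u v
      using that(2)
    proof
      assume "B \<le> u"
      then have "integral {-B..u} h + integral {u..v} h = integral {-B..v} h"
        using \<open>B > 0\<close> \<open>u \<le> v\<close> alt(1) by (intro Henstock_Kurzweil_Integration.integral_combine) auto
      then show ?thesis
        using B[OF b b, of "-B" u "-B" v] \<open>B \<le> u\<close> \<open>u \<le> v\<close> by auto
    next
      assume "v \<le> -B"
      then have "integral {u..v} h + integral {v..B} h = integral {u..B} h"
        using \<open>B > 0\<close> \<open>u \<le> v\<close> alt(1) by (intro Henstock_Kurzweil_Integration.integral_combine) auto
      then show ?thesis
        using B[OF b b, of u B v B] \<open>v \<le> -B\<close> \<open>u \<le> v\<close> by auto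
    qed
    then show "\<exists>B. \<forall>u v. u \<le> v \<and> (B \<le> u \<or> v \<le> - B) \<longrightarrow> \<bar>integral {u..v} h\<bar> \<le> \<epsilon>"
      by blast
  qed
next
  assume "?int \<and> ?tails"
  then have int: "h integrable_on {a..b}" for a b by blast
  have tails: ?tails using \<open>?int \<and> ?tails\<close> ..
  have "\<exists>B>0. \<forall>a b c d. ball 0 B \<subseteq> {a..b} \<and> ball 0 B \<subseteq> {c..d} \<longrightarrow>
        \<bar>integral {a..b} h - integral {c..d} h\<bar> < e" if "e > 0" for e
  proof -
    obtain B0 where B0: "\<And>u v. u \<le> v \<Longrightarrow> (B0 \<le> u \<or> v \<le> - B0) \<Longrightarrow> \<bar>integral {u..v} h\<bar> \<le> e/5"
      using tails \<open>e > 0\<close> by (meson divide_pos_pos zero_less_numeral)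
    define B where "B = max 1 B0"
    have near: "\<bar>integral {a..b} h - integral {-B..B} h\<bar> \<le> 2*e/5" if "ball 0 B \<subseteq> {a..b}" for a b
    proof -
      have "B > 0" by (simp add: B_def)
      then have "{-B..B} \<subseteq> {a..b}"
        using closure_mono[OF that] by (auto simp: cball_eq_atLeastAtMost)
      then have "a \<le> -B" "B \<le> b" using \<open>B > 0\<close> by auto
      moreover have "integral {a..-B} h + integral {-B..b} h = integral {a..b} h"
        "integral {-B..B} h + integral {B..b} h = integral {-B..b} h"
        using calculation int B_def by (auto intro!: Henstock_Kurzweil_Integration.integral_combine)
      moreover have "\<bar>integral {a..-B} h\<bar> \<le> e/5" "\<bar>integral {B..b} h\<bar> \<le> e/5"
        by (rule B0; use calculation(1,2) in \<open>simp add: B_def\<close>)+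
      ultimately show ?thesis by linarith
    qed
    have "\<bar>integral {a..b} h - integral {c..d} h\<bar> < e"
      if "ball 0 B \<subseteq> {a..b}" "ball 0 B \<subseteq> {c..d}" for a b c d
      using near[OF that(1)] near[OF that(2)] \<open>e > 0\<close> by linarith
    then show ?thesis by (intro exI[of _ B]) (auto simp: B_def)
  qed
  then show "h \<in> HK"
    unfolding HK_def mem_Collect_eq integrable_alt[of h UNIV] using int by simp
qed

text \<open>
  Makes unbounded and half-open intervals dispensable in the supremum that defines the Alexiewicz norm.
\<close>

lemma integral_interval_approx:
  fixes h :: "real \<Rightarrow> real"
  assumes "is_interval I" "h integrable_on I" "e > 0"
  shows "\<exists>c d. \<bar>integral I h - integral {c..d} h\<bar> < e"
proof -
  have "(h has_integral integral I h) I" using assms(2) by blast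
  then obtain B where "B > 0" and B: "\<And>a b. ball 0 B \<subseteq> {a..b} \<Longrightarrow>
      \<bar>integral {a..b} (\<lambda>x. if x \<in> I then h x else 0) - integral I h\<bar> < e"
    unfolding has_integral_alt'[of h _ I] using \<open>e > 0\<close> by (metis box_real(2) real_norm_def)
  define J where "J = I \<inter> {-B..B}"
  have eq: "integral {-B..B} (\<lambda>x. if x \<in> I then h x else 0) = integral J h"
    unfolding J_def by (rule integral_restrict_Int)
  have "\<exists>c d. integral J h = integral {c..d} h"
  proof (cases "J = {}")
    case True
    then have "integral J h = integral {1..0} h" by simp
    then show ?thesis by blast
  next
    case False
    have J: "is_interval J" unfolding J_def using assms(1) is_interval_cc is_interval_Int by blast
    have bdd: "bdd_below J" "bdd_above J"
      unfolding J_def by (auto intro!: bdd_belowI[of _ "-B"] bdd_aboveI[of _ B])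
    have "J \<subseteq> {Inf J..Sup J}" using bdd by (auto intro: cInf_lower cSup_upper)
    moreover have "{Inf J<..<Sup J} \<subseteq> J"
    proof
      fix y assume "y \<in> {Inf J<..<Sup J}"
      then obtain u v where "u \<in> J" "v \<in> J" "u < y" "y < v"
        using cInf_less_iff[OF False bdd(1)] less_cSup_iff[OF False bdd(2)] by auto
      then show "y \<in> J" using J unfolding is_interval_1 by (meson less_imp_le)
    qed
    ultimately have "J - {Inf J..Sup J} \<subseteq> {}" "{Inf J..Sup J} - J \<subseteq> {Inf J, Sup J}" by force+
    then have "integral J h = integral {Inf J..Sup J} h"
      by (intro integral_spike_set negligible_subset[OF negligible_finite[of "{Inf J, Sup J}"]]) blast+
    then show ?thesis by blast
  qed
  moreover have "ball 0 B \<subseteq> {-B..B}" by (auto simp: dist_real_def)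
  ultimately show ?thesis using B[of "-B" B] eq by (metis abs_minus_commute)
qed

text \<open>
  The equivalence holds for every function: where the integral over an interval does not exist, its default value
  0 satisfies the bound trivially.
\<close>

lemma alexiewicz_norm_le_iff:
  "alexiewicz_norm h \<le> ereal C \<longleftrightarrow> (\<forall>a b. \<bar>integral {a..b} h\<bar> \<le> C)"
proof
  assume "alexiewicz_norm h \<le> ereal C"
  then have "\<bar>integral I h\<bar> \<le> C" if "is_interval I" for I
    using that unfolding alexiewicz_norm_def SUP_le_iff by auto
  then show "\<forall>a b. \<bar>integral {a..b} h\<bar> \<le> C" using is_interval_cc by blast
next
  assume C: "\<forall>a b. \<bar>integral {a..b} h\<bar> \<le> C"
  have "\<bar>integral I h\<bar> \<le> C" if "is_interval I" for I
  proof (cases "h integrable_on I")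
    case False
    then show ?thesis using C[rule_format, of 1 0] by (simp add: not_integrable_integral)
  next
    case True
    have "\<bar>integral I h\<bar> \<le> C + e" if "e > 0" for e
    proof -
      obtain c d where "\<bar>integral I h - integral {c..d} h\<bar> < e"
        using integral_interval_approx \<open>is_interval I\<close> True \<open>e > 0\<close> by blast
      then show ?thesis using C[rule_format, of c d] by linarith
    qed
    then show ?thesis by (rule field_le_epsilon)
  qed
  then show "alexiewicz_norm h \<le> ereal C" unfolding alexiewicz_norm_def SUP_le_iff by auto
qed

lemma alexiewicz_tendsto_0_iff:
  "alexiewicz_tendsto_0 k \<longleftrightarrow> (\<forall>\<^sub>F x in at 0. k x \<in> HK) \<and>
    (\<forall>\<epsilon>>0. \<forall>\<^sub>F x in at 0. \<forall>a b. \<bar>integral {a..b} (k x)\<bar> \<le> \<epsilon>)"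
proof -
  have nonneg: "0 \<le> alexiewicz_norm h" for h
    unfolding alexiewicz_norm_def by (rule SUP_upper2[of "{}"]) (auto simp: zero_ereal_def)
  have "((\<lambda>x. alexiewicz_norm (k x)) \<longlongrightarrow> 0) (at 0) \<longleftrightarrow>
     (\<forall>\<epsilon>>0. \<forall>\<^sub>F x in at 0. alexiewicz_norm (k x) \<le> ereal \<epsilon>)"
  proof
    assume L: "((\<lambda>x. alexiewicz_norm (k x)) \<longlongrightarrow> 0) (at 0)"
    show "\<forall>\<epsilon>>0. \<forall>\<^sub>F x in at 0. alexiewicz_norm (k x) \<le> ereal \<epsilon>"
    proof (intro allI impI)
      fix \<epsilon> :: real assume "\<epsilon> > 0"
      then have "\<forall>\<^sub>F x in at 0. alexiewicz_norm (k x) < ereal \<epsilon>"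
        using order_tendstoD(2)[OF L, of "ereal \<epsilon>"] by simp
      then show "\<forall>\<^sub>F x in at 0. alexiewicz_norm (k x) \<le> ereal \<epsilon>"
        by eventually_elim auto
    qed
  next
    assume R: "\<forall>\<epsilon>>0. \<forall>\<^sub>F x in at 0. alexiewicz_norm (k x) \<le> ereal \<epsilon>"
    show "((\<lambda>x. alexiewicz_norm (k x)) \<longlongrightarrow> 0) (at 0)"
    proof (rule order_tendstoI)
      fix a :: ereal assume "a < 0"
      then show "\<forall>\<^sub>F x in at 0. a < alexiewicz_norm (k x)"
        by (intro always_eventually allI less_le_trans[OF _ nonneg])
    next
      fix a :: ereal assume "0 < a"
      then obtain \<epsilon> where "0 < ereal \<epsilon>" "ereal \<epsilon> < a" using ereal_dense2 by blast
      then show "\<forall>\<^sub>F x in at 0. alexiewicz_norm (k x) < a"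
        using R[rule_format, of \<epsilon>] by (auto elim!: eventually_mono)
    qed
  qed
  then show ?thesis unfolding alexiewicz_tendsto_0_def alexiewicz_norm_le_iff by simp
qed

text \<open>
  The primitive is continuous and has limits at both infinities, hence it is uniformly continuous.
\<close>

lemma HK_small_on_short_intervals:
  assumes "h \<in> HK" "\<epsilon> > 0"
  shows "\<exists>\<delta>>0. \<forall>u v. u \<le> v \<and> v \<le> u + \<delta> \<longrightarrow> \<bar>integral {u..v} h\<bar> \<le> \<epsilon>"
proof -
  have int: "h integrable_on {a..b}" for a b using assms HK_iff_Cauchy_tails by blast
  obtain B0 where B0: "\<And>u v. u \<le> v \<Longrightarrow> B0 \<le> u \<or> v \<le> - B0 \<Longrightarrow> \<bar>integral {u..v} h\<bar> \<le> \<epsilon>"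
    using assms unfolding HK_iff_Cauchy_tails by meson
  define B where "B = max 1 B0"
  define F where "F = (\<lambda>y. integral {-B-1..y} h)"
  have "uniformly_continuous_on {-B-1..B+1} F"
    unfolding F_def by (intro compact_uniformly_continuous indefinite_integral_continuous_1 int) simp
  then obtain d where "d > 0" and d: "\<And>u v. u \<in> {-B-1..B+1} \<Longrightarrow> v \<in> {-B-1..B+1} \<Longrightarrow>
      dist v u < d \<Longrightarrow> dist (F v) (F u) < \<epsilon>"
    unfolding uniformly_continuous_on_def using \<open>\<epsilon> > 0\<close> by meson
  have "\<bar>integral {u..v} h\<bar> \<le> \<epsilon>" if "u \<le> v" "v \<le> u + min (d/2) 1" for u v
  proof (cases "B \<le> u \<or> v \<le> - B")
    case True
    then show ?thesis by (intro B0[OF that(1)]) (auto simp: B_def max_def split: if_splits)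
  next
    case False
    have "F u + integral {u..v} h = F v"
      unfolding F_def using False that by (intro Henstock_Kurzweil_Integration.integral_combine int) auto
    moreover have "dist (F v) (F u) < \<epsilon>"
      using False that \<open>d > 0\<close> by (intro d) (auto simp: dist_real_def)
    ultimately show ?thesis by (auto simp: dist_real_def)
  qed
  then show ?thesis using \<open>d > 0\<close> by (intro exI[of _ "min (d/2) 1"]) auto
qed

text \<open>
  Density in the Alexiewicz norm amounts to uniform approximation of primitives. On a compact interval
  [-B, B] with small tails, a polynomial p approximates the primitive, and s is the derivative of p on [-B, B]
  and 0 outside. The primitive of s is then p after clamping the argument to [-B, B].
\<close>

lemma HK_approx_bounded:
  assumes "h \<in> HK" "\<epsilon> > 0"
  obtains s B C where "B \<ge> 0" "\<And>y. \<bar>s y\<bar> \<le> C"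
    "\<And>y. B < \<bar>y\<bar> \<Longrightarrow> s y = 0" "\<And>a b. s integrable_on {a..b}"
    "\<And>a b. \<bar>integral {a..b} (\<lambda>y. h y - s y)\<bar> \<le> \<epsilon>"
proof -
  have int: "h integrable_on {a..b}" for a b using assms HK_iff_Cauchy_tails by blast
  have "\<epsilon>/4 > 0" using assms by simp
  then obtain B0 where B0: "\<And>u v. u \<le> v \<Longrightarrow> B0 \<le> u \<or> v \<le> - B0 \<Longrightarrow> \<bar>integral {u..v} h\<bar> \<le> \<epsilon>/4"
    using assms(1) unfolding HK_iff_Cauchy_tails by meson
  define B where "B = max 1 B0"
  have tail: "\<bar>integral {u..v} h\<bar> \<le> \<epsilon>/4" if "u \<le> v" "B \<le> u \<or> v \<le> - B" for u v
    by (rule B0[OF that(1)]) (use that(2) in \<open>auto simp: B_def max_def split: if_splits\<close>)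
  have "B > 0" by (simp add: B_def)
  define F where "F = (\<lambda>y. integral {-B..y} h)"
  have "continuous_on {-B..B} F" unfolding F_def by (intro indefinite_integral_continuous_1 int)
  then obtain p where p: "real_polynomial_function p" "\<And>y. y \<in> {-B..B} \<Longrightarrow> \<bar>F y - p y\<bar> < \<epsilon>/4"
    using Stone_Weierstrass_real_polynomial_function[of "{-B..B}" F "\<epsilon>/4"] \<open>\<epsilon>/4 > 0\<close> by auto
  obtain p' where p': "polynomial_function p'" "\<And>y. (p has_real_derivative p' y) (at y)"
    using has_real_derivative_polynomial_function[of p] p(1)
    by (auto simp: real_polynomial_function_eq)
  have cont': "continuous_on S p'" for S using p'(1) continuous_on_polymonial_function by blast
  have cont: "continuous_on S p" for S using p(1) continuous_on_polymonial_function
    by (simp add: real_polynomial_function_eq)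
  define s where "s = (\<lambda>y. if \<bar>y\<bar> \<le> B then p' y else 0)"
  define cl where "cl = (\<lambda>y. max (-B) (min B y))"
  have s_int: "(s has_integral p (cl b) - p (cl a)) {a..b}" if "a \<le> b" for a b
  proof (rule fundamental_theorem_of_calculus_interior_strong[of "{-B,B}" a b "\<lambda>y. p (cl y)"])
    show "continuous_on {a..b} (\<lambda>y. p (cl y))"
      by (rule continuous_on_compose2[OF cont[of UNIV]]) (auto simp: cl_def intro!: continuous_intros)
    fix y assume "y \<in> {a<..<b} - {-B,B}"
    then consider "y < -B" | "-B < y \<and> y < B" | "B < y" by fastforce
    then have "((\<lambda>y. p (cl y)) has_real_derivative s y) (at y)"
    proof cases
      case 1
      have "((\<lambda>y. p (-B)) has_real_derivative s y) (at y)" using 1 \<open>B > 0\<close> by (auto simp: s_def)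
      then show ?thesis
        by (rule has_field_derivative_transform_within_open[of _ _ _ "{..<-B}"])
          (use 1 \<open>B > 0\<close> in \<open>auto simp: cl_def\<close>)
    next
      case 2
      have "(p has_real_derivative s y) (at y)" using 2 p'(2) by (auto simp: s_def)
      then show ?thesis
        by (rule has_field_derivative_transform_within_open[of _ _ _ "{-B<..<B}"])
          (use 2 in \<open>auto simp: cl_def\<close>)
    next
      case 3
      have "((\<lambda>y. p B) has_real_derivative s y) (at y)" using 3 by (auto simp: s_def)
      then show ?thesis
        by (rule has_field_derivative_transform_within_open[of _ _ _ "{B<..}"])
          (use 3 \<open>B > 0\<close> in \<open>auto simp: cl_def\<close>)
    qed
    then show "((\<lambda>y. p (cl y)) has_vector_derivative s y) (at y)"
      by (simp add: has_real_derivative_iff_has_vector_derivative)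
  qed (use that in auto)
  have s_int': "s integrable_on {a..b}" for a b
    using s_int[of a b] by (cases "a \<le> b") auto
  have "\<bar>integral {a..b} (\<lambda>y. h y - s y)\<bar> \<le> \<epsilon>" for a b
  proof (cases "a \<le> b")
    case True
    have clB: "cl a \<in> {-B..B}" "cl b \<in> {-B..B}" "cl a \<le> cl b" using True \<open>B > 0\<close> by (auto simp: cl_def)
    have "F (cl a) + integral {cl a..cl b} h = F (cl b)"
      unfolding F_def using clB by (intro Henstock_Kurzweil_Integration.integral_combine int) auto
    moreover have "\<bar>F (cl a) - p (cl a)\<bar> < \<epsilon>/4" "\<bar>F (cl b) - p (cl b)\<bar> < \<epsilon>/4" using p(2) clB by auto
    moreover have "\<bar>integral {a..b} h - integral {cl a..cl b} h\<bar> \<le> \<epsilon>/2"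
    proof (cases "b \<le> -B \<or> B \<le> a")
      case True
      then have "cl a = cl b" using \<open>a \<le> b\<close> \<open>B > 0\<close> by (auto simp: cl_def)
      then show ?thesis using tail[of a b] True \<open>a \<le> b\<close> \<open>\<epsilon> > 0\<close> by auto
    next
      case False
      have le: "a \<le> cl a" "cl b \<le> b" using False by (auto simp: cl_def)
      have "integral {a..cl a} h + integral {cl a..b} h = integral {a..b} h"
        "integral {cl a..cl b} h + integral {cl b..b} h = integral {cl a..b} h"
        using le clB by (auto intro!: Henstock_Kurzweil_Integration.integral_combine int)
      moreover have "\<bar>integral {a..cl a} h\<bar> \<le> \<epsilon>/4"
      proof (cases "a \<le> -B")
        case True
        then show ?thesis using tail[OF le(1)] \<open>B > 0\<close> by (auto simp: cl_def)
      next
        case False': False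
        then have "cl a = a" using False by (auto simp: cl_def)
        then show ?thesis using \<open>\<epsilon> > 0\<close> by simp
      qed
      moreover have "\<bar>integral {cl b..b} h\<bar> \<le> \<epsilon>/4"
      proof (cases "B \<le> b")
        case True
        then show ?thesis using tail[OF le(2)] \<open>B > 0\<close> by (auto simp: cl_def)
      next
        case False': False
        then have "cl b = b" using False by (auto simp: cl_def)
        then show ?thesis using \<open>\<epsilon> > 0\<close> by simp
      qed
      ultimately show ?thesis by linarith
    qed
    moreover have "integral {a..b} (\<lambda>y. h y - s y) = integral {a..b} h - (p (cl b) - p (cl a))"
      using integral_diff[OF int s_int'] integral_unique[OF s_int[OF True]] by simp
    ultimately show ?thesis by linarith
  qed (use \<open>\<epsilon> > 0\<close> in simp)
  moreover obtain C where "\<And>y. \<bar>s y\<bar> \<le> C"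
  proof -
    have "compact (p' ` {-B..B})" using cont' compact_continuous_image by blast
    then obtain C where "C > 0" "\<forall>y\<in>{-B..B}. \<bar>p' y\<bar> \<le> C"
      using compact_imp_bounded bounded_pos by (metis image_eqI real_norm_def)
    then show ?thesis by (intro that[of C]) (auto simp: s_def abs_le_iff)
  qed
  ultimately show ?thesis
    using that[of B s C] s_int' \<open>B > 0\<close> by (auto simp: s_def)
qed

section \<open>Differences of bounded monotone functions as multipliers\<close>

text \<open>
  Working form of "essentially bounded and of essential bounded variation": the monotone parts can be fed
  directly into the second mean value theorem, and a single constant replaces the two bounds.
\<close>

definition ess_mono_diff :: "(real \<Rightarrow> real) \<Rightarrow> real \<Rightarrow> bool" where
  "ess_mono_diff \<phi> M \<longleftrightarrow> (\<exists>P N. mono P \<and> mono N \<and> (\<forall>y. \<bar>P y\<bar> \<le> M \<and> \<bar>N y\<bar> \<le> M) \<and>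
     (AE y in lebesgue. \<phi> y = P y - N y))"

lemma mono_multiplier:
  fixes h P :: "real \<Rightarrow> real"
  assumes "h integrable_on {a..b}" "\<And>c d. a \<le> c \<Longrightarrow> d \<le> b \<Longrightarrow> \<bar>integral {c..d} h\<bar> \<le> \<eta>"
    and "mono P" "\<And>y. \<bar>P y\<bar> \<le> M"
  shows "(\<lambda>y. h y * P y) integrable_on {a..b}" "\<bar>integral {a..b} (\<lambda>y. h y * P y)\<bar> \<le> 2 * M * \<eta>"
proof -
  have "M \<ge> 0" using assms(4)[of 0] by linarith
  have "\<eta> \<ge> 0" using assms(2)[of a b] by linarith
  have *: "(\<lambda>y. h y * P y) integrable_on {a..b} \<and> \<bar>integral {a..b} (\<lambda>y. h y * P y)\<bar> \<le> 2 * M * \<eta>"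
  proof (cases "a \<le> b")
    case True
    obtain c where c: "c \<in> {a..b}"
      "((\<lambda>y. P y * h y) has_integral (P a * integral {a..c} h + P b * integral {c..b} h)) {a..b}"
      by (rule second_mean_value_theorem_full[OF assms(1) True, of P]) (auto intro: monoD[OF \<open>mono P\<close>])
    have "\<bar>P a * integral {a..c} h\<bar> \<le> M * \<eta>" "\<bar>P b * integral {c..b} h\<bar> \<le> M * \<eta>"
      using assms(2,4) c(1) \<open>M \<ge> 0\<close> by (auto simp: abs_mult intro!: mult_mono)
    then have "\<bar>P a * integral {a..c} h + P b * integral {c..b} h\<bar> \<le> 2 * M * \<eta>" by linarith
    then show ?thesis using c(2) by (auto simp: mult.commute has_integral_integrable_integral)
  qed (use \<open>M \<ge> 0\<close> \<open>\<eta> \<ge> 0\<close> in \<open>auto simp: integrable_on_empty\<close>)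
  then show "(\<lambda>y. h y * P y) integrable_on {a..b}" "\<bar>integral {a..b} (\<lambda>y. h y * P y)\<bar> \<le> 2 * M * \<eta>"
    by auto
qed

lemma AE_lebesgue_negligible:
  "(AE y in lebesgue. Q y) \<longleftrightarrow> negligible {y. \<not> Q y}"
  unfolding eventually_ae_filter_negligible using negligible_subset by blast

text \<open>
  The norm of h on [a, b] enters only through the bound \<open>\<eta>\<close>. By the second mean value theorem the integral of h
  times a monotone function P over [a, b] is P a times one integral of h plus P b times another.
\<close>

lemma ess_mono_diff_multiplier:
  fixes h \<phi> :: "real \<Rightarrow> real"
  assumes "h integrable_on {a..b}" "\<And>c d. a \<le> c \<Longrightarrow> d \<le> b \<Longrightarrow> \<bar>integral {c..d} h\<bar> \<le> \<eta>"
    and "ess_mono_diff \<phi> M"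
  shows "(\<lambda>y. h y * \<phi> y) integrable_on {a..b}" "\<bar>integral {a..b} (\<lambda>y. h y * \<phi> y)\<bar> \<le> 4 * M * \<eta>"
proof -
  obtain P N where PN: "mono P" "mono N" "\<And>y. \<bar>P y\<bar> \<le> M" "\<And>y. \<bar>N y\<bar> \<le> M"
    and ae: "AE y in lebesgue. \<phi> y = P y - N y"
    using assms(3) unfolding ess_mono_diff_def by auto
  let ?Z = "{y. \<phi> y \<noteq> P y - N y}"
  have neg: "negligible ?Z" using ae by (rule iffD1[OF AE_lebesgue_negligible])
  note P = mono_multiplier[OF assms(1,2) PN(1,3)] and N = mono_multiplier[OF assms(1,2) PN(2,4)]
  have eq: "h y * P y - h y * N y = h y * \<phi> y" if "y \<in> {a..b} - ?Z" for y
  proof -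
    have "\<phi> y = P y - N y" using that by blast
    then show ?thesis by (simp add: right_diff_distrib)
  qed
  have diff: "(\<lambda>y. h y * P y - h y * N y) integrable_on {a..b}" by (intro integrable_diff P N)
  show "(\<lambda>y. h y * \<phi> y) integrable_on {a..b}"
    by (rule integrable_spike[OF diff neg]) (simp only: eq)
  have "integral {a..b} (\<lambda>y. h y * \<phi> y) = integral {a..b} (\<lambda>y. h y * P y - h y * N y)"
    by (rule integral_spike[OF neg]) (simp only: eq)
  also have "\<dots> = integral {a..b} (\<lambda>y. h y * P y) - integral {a..b} (\<lambda>y. h y * N y)"
    by (intro integral_diff P N)
  finally show "\<bar>integral {a..b} (\<lambda>y. h y * \<phi> y)\<bar> \<le> 4 * M * \<eta>" using P(2) N(2) by linarith
qed

text \<open>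
  The multiplier inequality on intervals far out transfers the Cauchy condition from h to the product.
\<close>

lemma ess_mono_diff_multiplier_HK:
  assumes "h \<in> HK" "ess_mono_diff \<phi> M"
  shows "(\<lambda>y. h y * \<phi> y) \<in> HK"
proof -
  have int: "h integrable_on {a..b}" for a b using assms HK_iff_Cauchy_tails by blast
  have "M \<ge> 0" using assms(2) unfolding ess_mono_diff_def by (metis abs_ge_zero order_trans)
  have "(\<lambda>y. h y * \<phi> y) integrable_on {a..b}" for a b
  proof -
    have "continuous_on {a..b} (\<lambda>y. integral {a..y} h)"
      by (intro indefinite_integral_continuous_1 int)
    then have "compact ((\<lambda>y. integral {a..y} h) ` {a..b})" using compact_continuous_image by blast
    then obtain C where C: "C > 0" "\<And>y. y \<in> {a..b} \<Longrightarrow> \<bar>integral {a..y} h\<bar> \<le> C"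
      by (metis (no_types, lifting) bounded_pos compact_imp_bounded imageI real_norm_def)
    have "\<bar>integral {c..d} h\<bar> \<le> 2 * C" if "a \<le> c" "d \<le> b" for c d
    proof (cases "c \<le> d")
      case True
      then have "integral {a..c} h + integral {c..d} h = integral {a..d} h"
        using that by (intro Henstock_Kurzweil_Integration.integral_combine int) auto
      then show ?thesis using C(2)[of c] C(2)[of d] True that by auto
    qed (use C in simp)
    then show ?thesis using ess_mono_diff_multiplier(1)[OF int _ assms(2)] by blast
  qed
  moreover have "\<exists>B. \<forall>u v. u \<le> v \<and> (B \<le> u \<or> v \<le> - B) \<longrightarrow> \<bar>integral {u..v} (\<lambda>y. h y * \<phi> y)\<bar> \<le> \<epsilon>"
    if "\<epsilon> > 0" for \<epsilon>
  proof -
    have "\<epsilon> / (4 * M + 1) > 0" using \<open>\<epsilon> > 0\<close> \<open>M \<ge> 0\<close> by auto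
    then obtain B where B: "\<And>u v. u \<le> v \<Longrightarrow> B \<le> u \<or> v \<le> - B \<Longrightarrow> \<bar>integral {u..v} h\<bar> \<le> \<epsilon> / (4 * M + 1)"
      using assms(1) unfolding HK_iff_Cauchy_tails by meson
    have "\<bar>integral {u..v} (\<lambda>y. h y * \<phi> y)\<bar> \<le> \<epsilon>" if "u \<le> v" "B \<le> u \<or> v \<le> - B" for u v
    proof -
      have "\<bar>integral {c..d} h\<bar> \<le> \<epsilon> / (4 * M + 1)" if "u \<le> c" "d \<le> v" for c d
        using B[of c d] that \<open>B \<le> u \<or> v \<le> - B\<close> \<open>\<epsilon> / (4 * M + 1) > 0\<close> by (cases "c \<le> d") auto
      then have "\<bar>integral {u..v} (\<lambda>y. h y * \<phi> y)\<bar> \<le> 4 * M * (\<epsilon> / (4 * M + 1))"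
        using ess_mono_diff_multiplier(2)[OF int _ assms(2)] by blast
      also have "\<dots> \<le> \<epsilon>" using \<open>\<epsilon> > 0\<close> \<open>M \<ge> 0\<close> by (simp add: field_simps)
      finally show ?thesis .
    qed
    then show ?thesis by blast
  qed
  ultimately show ?thesis unfolding HK_iff_Cauchy_tails by blast
qed

section \<open>Essential variation and monotone decompositions\<close>

text \<open>
  Jordan decomposition relative to a set E, with extension of both parts to the whole line. The points of
  E will be Lebesgue points, where alone the values of the function are under control. Defining the parts as
  suprema over points of E to the left of y makes them monotone everywhere without taking one-sided limits.
\<close>

lemma bounded_variation_mono_decomposition:
  fixes \<phi> :: "real \<Rightarrow> real"
  assumes var: "\<And>n p. (\<And>i. i < n \<Longrightarrow> p i \<le> p (Suc i)) \<Longrightarrow> (\<And>i. i \<le> n \<Longrightarrow> p i \<in> E) \<Longrightarrow>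
      (\<Sum>i<n. \<bar>\<phi> (p (Suc i)) - \<phi> (p i)\<bar>) \<le> V"
    and bdd: "\<And>y. y \<in> E \<Longrightarrow> \<bar>\<phi> y\<bar> \<le> B" and "0 \<le> V" "0 \<le> B"
  obtains P N where "mono P" "mono N" "\<And>y. \<bar>P y\<bar> \<le> V + B" "\<And>y. \<bar>N y\<bar> \<le> V + B"
    "\<And>y. y \<in> E \<Longrightarrow> \<phi> y = P y - N y"
proof -
  define A where "A y = {\<Sum>i<n. \<bar>\<phi> (p (Suc i)) - \<phi> (p i)\<bar> | n p.
      (\<forall>i<n. p i \<le> p (Suc i)) \<and> (\<forall>i\<le>n. p i \<in> E \<and> p i \<le> y)}" for y
  \<comment> \<open>The elements 0 here and - B in the definition of N below only matter to the left of all points of E,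
  where the suprema would otherwise be taken over the empty set.\<close>
  define P where "P y = Sup (insert 0 (A y))" for y
  have A_le: "t \<le> V" if "t \<in> A y" for t y
    using that unfolding A_def by (auto intro!: var)
  have bddA: "bdd_above (insert 0 (A y))" for y
    using A_le \<open>0 \<le> V\<close> by (intro bdd_aboveI[of _ V]) auto
  have P_bounds: "0 \<le> P y" "P y \<le> V" for y
    unfolding P_def using A_le \<open>0 \<le> V\<close> by (auto intro!: cSup_upper bddA cSup_least)
  have "mono P"
  proof
    fix y y' :: real assume "y \<le> y'"
    then have "A y \<subseteq> A y'" unfolding A_def by (smt (verit) Collect_mono)
    then show "P y \<le> P y'" unfolding P_def by (intro cSup_subset_mono bddA) auto
  qed
  have step: "P y + \<bar>\<phi> y' - \<phi> y\<bar> \<le> P y'" if "y \<in> E" "y' \<in> E" "y \<le> y'" for y y'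
  proof -
    have ext: "t + \<bar>\<phi> y' - \<phi> y\<bar> \<le> P y'" if "t \<in> A y" for t
    proof -
      obtain n p where np: "t = (\<Sum>i<n. \<bar>\<phi> (p (Suc i)) - \<phi> (p i)\<bar>)"
        "\<forall>i<n. p i \<le> p (Suc i)" "\<forall>i\<le>n. p i \<in> E \<and> p i \<le> y"
        using \<open>t \<in> A y\<close> unfolding A_def by auto
      \<comment> \<open>Append y and then y' to a partition that ends at or before y.\<close>
      define q where "q i = (if i \<le> n then p i else if i = Suc n then y else y')" for i
      define t' where "t' = (\<Sum>i<Suc (Suc n). \<bar>\<phi> (q (Suc i)) - \<phi> (q i)\<bar>)"
      have "(\<Sum>i<n. \<bar>\<phi> (q (Suc i)) - \<phi> (q i)\<bar>) = t"
        unfolding np(1) by (intro sum.cong) (auto simp: q_def)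
      then have "t + \<bar>\<phi> y' - \<phi> y\<bar> \<le> t'"
        unfolding t'_def by (simp add: q_def)
      moreover have "t' \<in> A y'"
        unfolding A_def t'_def mem_Collect_eq
      proof (intro exI conjI allI impI)
        fix i assume "i < Suc (Suc n)"
        then consider "i < n" | "i = n" | "i = Suc n" by linarith
        then show "q i \<le> q (Suc i)"
          using np(2,3) \<open>y \<le> y'\<close> by cases (auto simp: q_def)
      next
        fix i
        show "q i \<in> E" "q i \<le> y'"
          using np(3) \<open>y \<le> y'\<close> \<open>y \<in> E\<close> \<open>y' \<in> E\<close> by (auto simp: q_def)
      qed (rule refl)
      then have "t' \<le> P y'" unfolding P_def by (intro cSup_upper bddA) auto
      ultimately show ?thesis by linarith
    qed
    have "0 \<in> A y"
      unfolding A_def mem_Collect_eq using \<open>y \<in> E\<close>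
      by (intro exI[of _ 0] exI[of _ "\<lambda>_. y"]) auto
    then have "P y \<le> P y' - \<bar>\<phi> y' - \<phi> y\<bar>"
      unfolding P_def[of y] using ext by (intro cSup_least) (auto simp: le_diff_eq)
    then show ?thesis by linarith
  qed
  define D where "D y = insert (- B) {P z - \<phi> z | z. z \<in> E \<and> z \<le> y}" for y
  define N where "N y = Sup (D y)" for y
  have D_le: "t \<le> V + B" if "t \<in> D y" for t y
  proof -
    consider "t = - B" | z where "t = P z - \<phi> z" "z \<in> E" using \<open>t \<in> D y\<close> unfolding D_def by auto
    then show ?thesis
    proof cases
      case 1
      then show ?thesis using \<open>0 \<le> V\<close> \<open>0 \<le> B\<close> by linarith
    next
      case 2
      then show ?thesis using P_bounds(2)[of z] bdd[OF 2(2)] by linarith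
    qed
  qed
  have bddD: "bdd_above (D y)" for y using D_le by (intro bdd_aboveI) auto
  have "mono N"
  proof
    fix y y' :: real assume "y \<le> y'"
    then have "D y \<subseteq> D y'" unfolding D_def by fastforce
    moreover have "D y \<noteq> {}" unfolding D_def by blast
    ultimately show "N y \<le> N y'" unfolding N_def by (intro cSup_subset_mono bddD)
  qed
  have "\<bar>N y\<bar> \<le> V + B" for y
  proof -
    have "N y \<le> V + B" unfolding N_def using D_le by (intro cSup_least) (auto simp: D_def)
    moreover have "- B \<le> N y" unfolding N_def by (intro cSup_upper bddD) (auto simp: D_def)
    ultimately show ?thesis using \<open>0 \<le> V\<close> by linarith
  qed
  moreover have "\<phi> y = P y - N y" if "y \<in> E" for y
  proof -
    have "N y = P y - \<phi> y"
      unfolding N_def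
    proof (rule cSup_eq_maximum)
      show "P y - \<phi> y \<in> D y" unfolding D_def using that by auto
      fix t assume "t \<in> D y"
      then consider "t = -B" | z where "t = P z - \<phi> z" "z \<in> E" "z \<le> y" unfolding D_def by auto
      then show "t \<le> P y - \<phi> y"
      proof cases
        case 1
        then show ?thesis using P_bounds(1)[of y] bdd[OF that] by linarith
      next
        case 2
        then show ?thesis using step[OF 2(2) that 2(3)] by linarith
      qed
    qed
    then show ?thesis by simp
  qed
  moreover have "\<bar>P y\<bar> \<le> V + B" for y using P_bounds[of y] \<open>0 \<le> B\<close> by linarith
  ultimately show ?thesis using that \<open>mono P\<close> \<open>mono N\<close> by blast
qed

text \<open>
  The essential variation is an infimum that need not be attained, hence the slack 1 in the variation. A representative
  of small variation that is bounded by M at one point is bounded everywhere.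
\<close>

lemma ess_mono_diffI:
  assumes "esssup lebesgue (\<lambda>y. ereal \<bar>\<phi> y\<bar>) \<le> ereal M" "essential_variation \<phi> \<le> ereal M"
  shows "ess_mono_diff \<phi> (3 * M + 2)"
proof -
  have "essential_variation \<phi> < ereal (M + 1)"
    using assms(2) by (rule le_less_trans) simp
  then obtain h where h: "AE y in lebesgue. h y = \<phi> y" "total_variation h < ereal (M + 1)"
    unfolding essential_variation_def INF_less_iff by auto
  have var: "(\<Sum>i<n. \<bar>h (p (Suc i)) - h (p i)\<bar>) \<le> M + 1" if "\<And>i. i < n \<Longrightarrow> p i \<le> p (Suc i)"
    for n and p :: "nat \<Rightarrow> real"
  proof -
    have "(\<Sum>i<n. ereal \<bar>h (p (Suc i)) - h (p i)\<bar>) \<le> total_variation h"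
      unfolding total_variation_def by (rule SUP_upper2[of "(n, p)"]) (use that in auto)
    then have "ereal (\<Sum>i<n. \<bar>h (p (Suc i)) - h (p i)\<bar>) < ereal (M + 1)"
      using h(2) by (simp only: sum_ereal le_less_trans)
    then show ?thesis by simp
  qed
  have "AE y in lebesgue. ereal \<bar>\<phi> y\<bar> \<le> ereal M"
    using esssup_AE[of "\<lambda>y. ereal \<bar>\<phi> y\<bar>" lebesgue]
    by eventually_elim (rule order_trans[OF _ assms(1)])
  then have "AE y in lebesgue. h y = \<phi> y \<and> \<bar>\<phi> y\<bar> \<le> M"
    using h(1) by eventually_elim auto
  then have "negligible {y. \<not> (h y = \<phi> y \<and> \<bar>\<phi> y\<bar> \<le> M)}"
    by (rule iffD1[OF AE_lebesgue_negligible])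
  then have "{y. \<not> (h y = \<phi> y \<and> \<bar>\<phi> y\<bar> \<le> M)} \<noteq> UNIV" using non_negligible_UNIV by metis
  then obtain z where z: "h z = \<phi> z" "\<bar>\<phi> z\<bar> \<le> M" by auto
  \<comment> \<open>Compare with the value at z through the two-point partition between y and z.\<close>
  have bdd: "\<bar>h y\<bar> \<le> 2 * M + 1" for y
  proof -
    have "\<bar>h (max y z) - h (min y z)\<bar> \<le> M + 1"
      using var[of 1 "\<lambda>i. if i = 0 then min y z else max y z"] by simp
    then show ?thesis using z by (cases "y \<le> z") (auto simp: max_def min_def)
  qed
  have "0 \<le> M" using z(2) by linarith
  obtain P N where "mono P" "mono N" "\<And>y. \<bar>P y\<bar> \<le> (M + 1) + (2 * M + 1)"
    "\<And>y. \<bar>N y\<bar> \<le> (M + 1) + (2 * M + 1)" and eq: "\<And>y. y \<in> UNIV \<Longrightarrow> h y = P y - N y"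
    by (rule bounded_variation_mono_decomposition[of UNIV h "M + 1" "2 * M + 1"])
      (use var bdd \<open>0 \<le> M\<close> in \<open>assumption | simp\<close>)+
  moreover have "AE y in lebesgue. \<phi> y = P y - N y"
    using h(1) by eventually_elim (use eq in auto)
  ultimately show ?thesis
    unfolding ess_mono_diff_def by (intro exI[of _ P] exI[of _ N]) (auto simp: algebra_simps)
qed

lemma ess_mono_diff_AE:
  assumes "ess_mono_diff \<phi> M"
  shows "\<phi> \<in> borel_measurable lebesgue" "AE y in lebesgue. \<bar>\<phi> y\<bar> \<le> 2 * M"
proof -
  obtain P N where PN: "mono P" "mono N" "\<And>y. \<bar>P y\<bar> \<le> M" "\<And>y. \<bar>N y\<bar> \<le> M"
    and ae: "AE y in lebesgue. \<phi> y = P y - N y"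
    using assms unfolding ess_mono_diff_def by auto
  have "(\<lambda>y. P y - N y) \<in> borel_measurable borel"
    using borel_measurable_mono PN(1,2) by measurable
  then have "(\<lambda>y. P y - N y) \<in> borel_measurable lebesgue"
    by (simp add: measurable_completion)
  moreover have "AE y in lebesgue. P y - N y = \<phi> y" using ae by eventually_elim simp
  ultimately show "\<phi> \<in> borel_measurable lebesgue"
    using borel_measurable_AE by blast
  show "AE y in lebesgue. \<bar>\<phi> y\<bar> \<le> 2 * M"
    using ae
  proof eventually_elim
    case (elim y)
    then show ?case using PN(3,4)[of y] by linarith
  qed
qed

lemma ess_mono_diffD:
  assumes "ess_mono_diff \<phi> M"
  shows "esssup lebesgue (\<lambda>y. ereal \<bar>\<phi> y\<bar>) \<le> ereal (4 * M)" "essential_variation \<phi> \<le> ereal (4 * M)"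
proof -
  obtain P N where PN: "mono P" "mono N" "\<And>y. \<bar>P y\<bar> \<le> M" "\<And>y. \<bar>N y\<bar> \<le> M"
    and ae: "AE y in lebesgue. \<phi> y = P y - N y"
    using assms unfolding ess_mono_diff_def by auto
  have "0 \<le> M" using PN(3)[of 0] by linarith
  have "AE y in lebesgue. ereal \<bar>\<phi> y\<bar> \<le> ereal (4 * M)"
    using ess_mono_diff_AE(2)[OF assms] by eventually_elim (use \<open>0 \<le> M\<close> in auto)
  moreover have "(\<lambda>y. ereal \<bar>\<phi> y\<bar>) \<in> borel_measurable lebesgue"
    using ess_mono_diff_AE(1)[OF assms] by measurable
  ultimately show "esssup lebesgue (\<lambda>y. ereal \<bar>\<phi> y\<bar>) \<le> ereal (4 * M)"
    by (intro esssup_I)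
  have var: "(\<Sum>i<n. \<bar>(P (p (Suc i)) - N (p (Suc i))) - (P (p i) - N (p i))\<bar>) \<le> 4 * M"
    if "\<forall>i<n. p i \<le> p (Suc i)" for n and p :: "nat \<Rightarrow> real"
  proof -
    have "(\<Sum>i<n. \<bar>(P (p (Suc i)) - N (p (Suc i))) - (P (p i) - N (p i))\<bar>)
        \<le> (\<Sum>i<n. (P (p (Suc i)) + N (p (Suc i))) - (P (p i) + N (p i)))"
    proof (rule sum_mono)
      fix i assume "i \<in> {..<n}"
      then have "P (p i) \<le> P (p (Suc i))" "N (p i) \<le> N (p (Suc i))"
        using that PN(1,2) by (auto simp: mono_def)
      then show "\<bar>(P (p (Suc i)) - N (p (Suc i))) - (P (p i) - N (p i))\<bar>
          \<le> (P (p (Suc i)) + N (p (Suc i))) - (P (p i) + N (p i))" by linarith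
    qed
    also have "\<dots> = (P (p n) + N (p n)) - (P (p 0) + N (p 0))"
      by (rule sum_lessThan_telescope)
    also have "\<dots> \<le> 4 * M"
      using PN(3)[of "p n"] PN(3)[of "p 0"] PN(4)[of "p n"] PN(4)[of "p 0"] by linarith
    finally show ?thesis .
  qed
  have "AE y in lebesgue. P y - N y = \<phi> y" using ae by eventually_elim simp
  then have "essential_variation \<phi> \<le> total_variation (\<lambda>y. P y - N y)"
    unfolding essential_variation_def by (intro INF_lower) simp
  also have "\<dots> \<le> ereal (4 * M)"
    unfolding total_variation_def by (rule SUP_least) (use var in \<open>auto simp del: ereal_less_eq simp: sum_ereal ereal_less_eq(3)\<close>)
  finally show "essential_variation \<phi> \<le> ereal (4 * M)" .
qed

section \<open>Duality between test functions and variation\<close>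

text \<open>
  Bounded measurable functions with bounded support, normalised in the Alexiewicz norm. Boundedness makes the pairing with
  a locally absolutely integrable function meaningful, and the class is stable under cutting off at a point.
\<close>

definition test_function :: "real set \<Rightarrow> (real \<Rightarrow> real) \<Rightarrow> bool" where
  "test_function A s \<longleftrightarrow> s \<in> borel_measurable borel \<and> bounded (range s) \<and>
     bounded {y. s y \<noteq> 0} \<and> {y. s y \<noteq> 0} \<subseteq> A \<and> (\<forall>a b. \<bar>integral {a..b} s\<bar> \<le> 1)"

text \<open>
  The primitive of the normalised indicator function of [p, p + \<open>\<eta>\<close>].
\<close>

definition ramp :: "real \<Rightarrow> real \<Rightarrow> real \<Rightarrow> real" where
  "ramp \<eta> p y = max 0 (min 1 ((y - p) / \<eta>))"

lemma has_integral_bump: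
  assumes "0 < \<eta>" "a \<le> b"
  shows "((\<lambda>y. indicator {p..p + \<eta>} y / \<eta>) has_integral (ramp \<eta> p b - ramp \<eta> p a)) {a..b}"
proof -
  let ?S = "{max a p..min b (p + \<eta>)}"
  have "((\<lambda>y. 1 / \<eta>) has_integral measure lborel ?S *\<^sub>R (1 / \<eta>)) ?S" by (rule has_integral_const_real)
  then have "((\<lambda>y. if y \<in> ?S then 1 / \<eta> else 0) has_integral measure lborel ?S *\<^sub>R (1 / \<eta>)) {a..b}"
    by (subst has_integral_restrict) auto
  then have "((\<lambda>y. indicator {p..p + \<eta>} y / \<eta>) has_integral measure lborel ?S *\<^sub>R (1 / \<eta>)) {a..b}"
    by (rule has_integral_eq[rotated]) (auto simp: indicator_def)
  moreover have "measure lborel ?S *\<^sub>R (1 / \<eta>) = ramp \<eta> p b - ramp \<eta> p a"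
  proof -
    have "measure lborel ?S = max 0 (min b (p + \<eta>) - max a p)" by (simp add: content_real_if max_def)
    also have "\<dots> = max 0 (min \<eta> (b - p)) - max 0 (min \<eta> (a - p))"
      using assms by (auto simp: max_def min_def)
    moreover have "ramp \<eta> p y = max 0 (min \<eta> (y - p)) / \<eta>" for y
      using \<open>0 < \<eta>\<close> by (simp add: ramp_def max_divide_distrib_right min_divide_distrib_right)
    ultimately show ?thesis by (simp add: diff_divide_distrib)
  qed
  ultimately show ?thesis by simp
qed

lemma ramp_bounds: "0 \<le> ramp \<eta> p y" "ramp \<eta> p y \<le> 1" by (auto simp: ramp_def)

lemma ramp_antimono: "0 < \<eta> \<Longrightarrow> p \<le> q \<Longrightarrow> ramp \<eta> q y \<le> ramp \<eta> p y"
  unfolding ramp_def by (intro max.mono min.mono divide_right_mono) auto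

lemma integral_bump_times:
  fixes \<phi> :: "real \<Rightarrow> real"
  assumes "\<phi> integrable_on {p..p + \<eta>}"
  shows "((\<lambda>y. indicator {p..p + \<eta>} y / \<eta> * \<phi> y) has_integral (integral {p..p + \<eta>} \<phi> / \<eta>)) UNIV"
proof -
  have "((\<lambda>y. \<phi> y / \<eta>) has_integral (integral {p..p + \<eta>} \<phi> / \<eta>)) {p..p + \<eta>}"
    using assms by (intro has_integral_divide integrable_integral)
  then have "((\<lambda>y. if y \<in> {p..p + \<eta>} then \<phi> y / \<eta> else 0) has_integral (integral {p..p + \<eta>} \<phi> / \<eta>)) UNIV"
    by (simp only: has_integral_restrict_UNIV)
  then show ?thesis
    by (rule has_integral_eq[rotated]) (auto simp: indicator_def)
qed

text \<open>
  Pairing with the normalised indicator function of [p, p + \<open>\<eta>\<close>] gives a mean value, which tends to the value at p for almost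
  every p. So pairing with signed differences of such functions approximates the variation over a partition
  p_0, ..., p_n. The Alexiewicz norm of these combinations stays bounded because their primitives are signed sums of
  differences of ramps with starting points p_i, and at each place the ramps decrease in i, so that the absolute values of
  the differences telescope.
\<close>

lemma ess_mono_diff_by_duality:
  fixes \<phi> :: "real \<Rightarrow> real"
  assumes int: "\<And>a b. \<phi> integrable_on {a..b}"
    and dual: "\<And>s. test_function UNIV s \<Longrightarrow> \<bar>integral UNIV (\<lambda>y. s y * \<phi> y)\<bar> \<le> K"
  shows "ess_mono_diff \<phi> (3 * K)"
proof -
  define avg where "avg \<eta> p = integral {p..p + \<eta>} \<phi> / \<eta>" for \<eta> p
  obtain Z where "negligible Z" and Z: "\<And>x e. x \<notin> Z \<Longrightarrow> 0 < e \<Longrightarrow>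
      \<exists>d>0. \<forall>h. 0 < h \<and> h < d \<longrightarrow> \<bar>integral {x..x + h} \<phi> / h - \<phi> x\<bar> < e"
    using integrable_ccontinuous_explicit[of \<phi>] int
    by (auto simp: divide_inverse mult.commute)
  have lim: "((\<lambda>\<eta>. avg \<eta> p) \<longlongrightarrow> \<phi> p) (at_right 0)" if p: "p \<notin> Z" for p
  proof (rule tendstoI)
    fix e :: real assume "e > 0"
    then obtain d where "d > 0" "\<forall>h. 0 < h \<and> h < d \<longrightarrow> \<bar>avg h p - \<phi> p\<bar> < e"
      using Z[OF p] unfolding avg_def by blast
    then show "\<forall>\<^sub>F \<eta> in at_right 0. dist (avg \<eta> p) (\<phi> p) < e"
      unfolding eventually_at_right_field dist_real_def by blast
  qed
  have bump_props: "(\<lambda>y. indicator {p..p + \<eta>} y / \<eta> :: real) \<in> borel_measurable borel"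
    "\<bar>indicator {p..p + \<eta>} y / \<eta> :: real\<bar> \<le> 1 / \<bar>\<eta>\<bar>" for p \<eta> y
    by (auto simp: indicator_def)
  have bdd: "\<bar>\<phi> p\<bar> \<le> K" if "p \<notin> Z" for p
  proof -
    have "\<bar>avg \<eta> p\<bar> \<le> K" if "\<eta> > 0" for \<eta>
    proof -
      let ?s = "\<lambda>y. indicator {p..p + \<eta>} y / \<eta>"
      have "test_function UNIV ?s"
        unfolding test_function_def
      proof (intro conjI allI)
        show "bounded (range ?s)" using bump_props(2) by (intro boundedI) auto
        show "bounded {y. ?s y \<noteq> 0}"
          by (rule bounded_subset[of "{p..p + \<eta>}"]) (auto simp: indicator_def)
        fix a b
        show "\<bar>integral {a..b} ?s\<bar> \<le> 1"
        proof (cases "a \<le> b")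
          case True
          then show ?thesis
            using integral_unique[OF has_integral_bump[OF \<open>\<eta> > 0\<close> True]]
              ramp_bounds[of \<eta> p a] ramp_bounds[of \<eta> p b] by (simp add: abs_le_iff)
        qed simp
      qed (use bump_props in auto)
      then show ?thesis
        using dual[of ?s] integral_unique[OF integral_bump_times[OF int, of p \<eta>]] \<open>\<eta> > 0\<close> unfolding avg_def by simp
    qed
    then have "\<forall>\<^sub>F \<eta> in at_right 0. \<bar>avg \<eta> p\<bar> \<le> K"
      by (auto simp: eventually_at_right_field intro: exI[of _ 1])
    moreover have "((\<lambda>\<eta>. \<bar>avg \<eta> p\<bar>) \<longlongrightarrow> \<bar>\<phi> p\<bar>) (at_right 0)"
      using lim[OF that] by (rule tendsto_rabs)
    ultimately show ?thesis by (intro tendsto_upperbound) auto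
  qed
  have var: "(\<Sum>i<n. \<bar>\<phi> (p (Suc i)) - \<phi> (p i)\<bar>) \<le> 2 * K"
    if p: "\<And>i. i < n \<Longrightarrow> p i \<le> p (Suc i)" "\<And>i. i \<le> n \<Longrightarrow> p i \<in> - Z" for n p
  proof -
    \<comment> \<open>These signs turn the pairing into the sum of absolute values.\<close>
    define e where "e i = sgn (\<phi> (p (Suc i)) - \<phi> (p i))" for i
    have "\<bar>e i\<bar> \<le> 1" for i by (simp add: e_def sgn_if)
    have bound: "(\<Sum>i<n. e i * (avg \<eta> (p (Suc i)) - avg \<eta> (p i))) \<le> 2 * K" if "\<eta> > 0" for \<eta>
    proof -
      \<comment> \<open>The factor 1/2 is needed since an integral over [a, b] is a difference of two values of the primitive,
      each of which is at most 1 before halving.\<close>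
      define s where "s y = (\<Sum>i<n. e i / 2 * (indicator {p (Suc i)..p (Suc i) + \<eta>} y / \<eta>
          - indicator {p i..p i + \<eta>} y / \<eta>))" for y
      have "test_function UNIV s"
        unfolding test_function_def
      proof (intro conjI allI)
        show "s \<in> borel_measurable borel" unfolding s_def using bump_props(1) by measurable
        have "\<bar>s y\<bar> \<le> (\<Sum>i<n. 1 / \<eta>)" for y
          unfolding s_def
        proof (intro order.trans[OF sum_abs] sum_mono)
          fix i
          have "\<bar>e i / 2\<bar> * \<bar>indicator {p (Suc i)..p (Suc i) + \<eta>} y / \<eta> - indicator {p i..p i + \<eta>} y / \<eta>\<bar>
              \<le> 1 * (1 / \<eta>)"
            using \<open>\<bar>e i\<bar> \<le> 1\<close> \<open>\<eta> > 0\<close> by (intro mult_mono) (auto simp: indicator_def)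
          then show "\<bar>e i / 2 * (indicator {p (Suc i)..p (Suc i) + \<eta>} y / \<eta> - indicator {p i..p i + \<eta>} y / \<eta>)\<bar>
              \<le> 1 / \<eta>" by (simp add: abs_mult)
        qed
        then show "bounded (range s)" by (intro boundedI) auto
        have "{y. s y \<noteq> 0} \<subseteq> (\<Union>i\<le>n. {p i..p i + \<eta>})"
        proof
          fix y assume y: "y \<in> {y. s y \<noteq> 0}"
          show "y \<in> (\<Union>i\<le>n. {p i..p i + \<eta>})"
          proof (rule ccontr)
            assume "y \<notin> (\<Union>i\<le>n. {p i..p i + \<eta>})"
            then have "indicator {p i..p i + \<eta>} y = (0::real)" if "i \<le> n" for i
              using that unfolding indicator_def by auto
            then have "s y = 0" unfolding s_def by (intro sum.neutral) auto
            then show False using y by simp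
          qed
        qed
        moreover have "bounded (\<Union>i\<le>n. {p i..p i + \<eta>})" by auto
        ultimately show "bounded {y. s y \<noteq> 0}" using bounded_subset by blast
        fix a b
        show "\<bar>integral {a..b} s\<bar> \<le> 1"
        proof (cases "a \<le> b")
          case True
          have tele: "\<bar>\<Sum>i<n. e i * (ramp \<eta> (p (Suc i)) c - ramp \<eta> (p i) c)\<bar> \<le> 1" for c
          proof -
            have "\<bar>\<Sum>i<n. e i * (ramp \<eta> (p (Suc i)) c - ramp \<eta> (p i) c)\<bar>
                \<le> (\<Sum>i<n. ramp \<eta> (p i) c - ramp \<eta> (p (Suc i)) c)"
            proof (intro order.trans[OF sum_abs] sum_mono)
              fix i assume "i \<in> {..<n}"
              then have "ramp \<eta> (p (Suc i)) c \<le> ramp \<eta> (p i) c"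
                using p(1) \<open>\<eta> > 0\<close> by (intro ramp_antimono) auto
              then show "\<bar>e i * (ramp \<eta> (p (Suc i)) c - ramp \<eta> (p i) c)\<bar>
                  \<le> ramp \<eta> (p i) c - ramp \<eta> (p (Suc i)) c"
                using mult_right_mono[OF \<open>\<bar>e i\<bar> \<le> 1\<close>, of "\<bar>ramp \<eta> (p (Suc i)) c - ramp \<eta> (p i) c\<bar>"]
                by (simp add: abs_mult)
            qed
            also have "\<dots> = ramp \<eta> (p 0) c - ramp \<eta> (p n) c" by (rule sum_lessThan_telescope')
            also have "\<dots> \<le> 1" using ramp_bounds[of \<eta> "p 0" c] ramp_bounds[of \<eta> "p n" c] by linarith
            finally show ?thesis .
          qed
          have "(s has_integral (\<Sum>i<n. e i / 2 * ((ramp \<eta> (p (Suc i)) b - ramp \<eta> (p (Suc i)) a)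
              - (ramp \<eta> (p i) b - ramp \<eta> (p i) a)))) {a..b}"
            unfolding s_def
            by (intro has_integral_sum has_integral_mult_right has_integral_diff has_integral_bump \<open>\<eta> > 0\<close> True) simp
          also have "(\<Sum>i<n. e i / 2 * ((ramp \<eta> (p (Suc i)) b - ramp \<eta> (p (Suc i)) a)
              - (ramp \<eta> (p i) b - ramp \<eta> (p i) a))) =
              ((\<Sum>i<n. e i * (ramp \<eta> (p (Suc i)) b - ramp \<eta> (p i) b)) -
               (\<Sum>i<n. e i * (ramp \<eta> (p (Suc i)) a - ramp \<eta> (p i) a))) / 2"
            unfolding sum_subtractf[symmetric] sum_divide_distrib
            by (intro sum.cong refl) (simp add: field_simps)
          finally have "integral {a..b} s = \<dots>" by (rule integral_unique)
          then show ?thesis using tele[of a] tele[of b] by (simp add: abs_le_iff)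
        qed simp
      qed simp
      then have "\<bar>integral UNIV (\<lambda>y. s y * \<phi> y)\<bar> \<le> K" by (rule dual)
      moreover have "((\<lambda>y. s y * \<phi> y) has_integral
          (\<Sum>i<n. e i / 2 * (avg \<eta> (p (Suc i)) - avg \<eta> (p i)))) UNIV"
      proof -
        have "((\<lambda>y. \<Sum>i<n. e i / 2 * (indicator {p (Suc i)..p (Suc i) + \<eta>} y / \<eta> * \<phi> y
            - indicator {p i..p i + \<eta>} y / \<eta> * \<phi> y)) has_integral
          (\<Sum>i<n. e i / 2 * (avg \<eta> (p (Suc i)) - avg \<eta> (p i)))) UNIV"
          unfolding avg_def
          by (intro has_integral_sum has_integral_mult_right has_integral_diff integral_bump_times int) simp
        then show ?thesis
          by (simp add: s_def sum_distrib_right left_diff_distrib mult.assoc)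
      qed
      ultimately have "(\<Sum>i<n. e i / 2 * (avg \<eta> (p (Suc i)) - avg \<eta> (p i))) \<le> K"
        by (simp add: integral_unique abs_le_iff)
      then show ?thesis
        by (simp add: sum_divide_distrib[symmetric])
    qed
    have "((\<lambda>\<eta>. \<Sum>i<n. e i * (avg \<eta> (p (Suc i)) - avg \<eta> (p i))) \<longlongrightarrow>
        (\<Sum>i<n. e i * (\<phi> (p (Suc i)) - \<phi> (p i)))) (at_right 0)"
      by (intro tendsto_intros lim) (use p(2) in auto)
    moreover have "\<forall>\<^sub>F \<eta> in at_right 0. (\<Sum>i<n. e i * (avg \<eta> (p (Suc i)) - avg \<eta> (p i))) \<le> 2 * K"
      using bound by (auto simp: eventually_at_right_field intro: exI[of _ 1])
    ultimately have "(\<Sum>i<n. e i * (\<phi> (p (Suc i)) - \<phi> (p i))) \<le> 2 * K"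
      by (intro tendsto_upperbound) auto
    moreover have "e i * (\<phi> (p (Suc i)) - \<phi> (p i)) = \<bar>\<phi> (p (Suc i)) - \<phi> (p i)\<bar>" for i
      by (simp add: e_def sgn_if)
    ultimately show ?thesis by simp
  qed
  have "0 \<le> K"
  proof -
    have "test_function UNIV (\<lambda>_. 0)" by (simp add: test_function_def)
    then show ?thesis using dual by fastforce
  qed
  obtain P N where "mono P" "mono N" "\<And>y. \<bar>P y\<bar> \<le> 2 * K + K" "\<And>y. \<bar>N y\<bar> \<le> 2 * K + K"
    and eq: "\<And>y. y \<in> - Z \<Longrightarrow> \<phi> y = P y - N y"
    by (rule bounded_variation_mono_decomposition[of "- Z" \<phi> "2 * K" K])
      (use var bdd \<open>0 \<le> K\<close> in \<open>assumption | simp\<close>)+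
  moreover have "AE y in lebesgue. \<phi> y = P y - N y"
    unfolding AE_lebesgue_negligible
    by (rule negligible_subset[OF \<open>negligible Z\<close>]) (use eq in auto)
  ultimately show ?thesis
    unfolding ess_mono_diff_def by (intro exI[of _ P] exI[of _ N]) auto
qed

section \<open>Sums of disjoint humps\<close>

lemma continuous_real_antiderivative:
  fixes f :: "real \<Rightarrow> real"
  assumes "continuous_on UNIV f"
  shows "\<exists>F. F 0 = 0 \<and> (\<forall>y. (F has_real_derivative f y) (at y))"
proof -
  have "isCont f y" for y using assms by (simp add: continuous_on_eq_continuous_at)
  then obtain F where F: "\<And>y. (F has_real_derivative f y) (at y)"
    using einterval_antiderivative[of "-\<infinity>" "\<infinity>" f]
    by (auto simp: has_real_derivative_iff_has_vector_derivative)
  then have "((\<lambda>y. F y - F 0) has_real_derivative f y) (at y)" for y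
    using DERIV_diff[OF F[of y] DERIV_const[of "F 0"]] by simp
  then show ?thesis by (intro exI[of _ "\<lambda>y. F y - F 0"]) simp
qed

text \<open>
  The sum of the functions s_k / 2^k need not be absolutely integrable near z, since only the Alexiewicz norms of the s_k are bounded.
  But the series of primitives converges uniformly, so its sum is continuous, and away from z it is locally a
  finite sum plus a constant. The fundamental theorem of calculus tolerates the one exceptional point z, at which the improper
  integral is hidden. If the supports escape to infinity instead, the derivative exists at z as well, and the
  series of primitives yields the Cauchy condition at infinity.
\<close>

lemma disjoint_humps_HK:
  fixes s :: "nat \<Rightarrow> real \<Rightarrow> real"
  assumes cont: "\<And>k. continuous_on UNIV (s k)"
    and supp: "\<And>k. bounded {y. s k y \<noteq> 0}"
    and norm: "\<And>k a b. \<bar>integral {a..b} (s k)\<bar> \<le> 2"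
    and locfin: "\<And>y. y \<noteq> z \<Longrightarrow> \<exists>e>0. \<exists>N. \<forall>k\<ge>N. \<forall>t. \<bar>t - y\<bar> < e \<longrightarrow> s k t = 0"
  shows "(\<lambda>y. \<Sum>k. s k y / 2 ^ k) \<in> HK"
proof -
  have "\<forall>k. \<exists>F. F 0 = 0 \<and> (\<forall>y. (F has_real_derivative s k y) (at y))"
    using continuous_real_antiderivative cont by blast
  then obtain S where S0: "\<And>k. S k 0 = 0" and S: "\<And>k y. (S k has_real_derivative s k y) (at y)"
    by metis
  have S_int: "(s k has_integral S k b - S k a) {a..b}" if "a \<le> b" for k a b
    by (rule fundamental_theorem_of_calculus[OF that])
      (simp add: S has_field_derivative_at_within flip: has_real_derivative_iff_has_vector_derivative)
  have S_diff: "\<bar>S k b - S k a\<bar> \<le> 2" for k a b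
  proof (cases "a \<le> b")
    case True
    then show ?thesis using norm[of a b k] integral_unique[OF S_int] by metis
  next
    case False
    then show ?thesis using norm[of b a k] integral_unique[OF S_int, of b a k] by simp
  qed
  have S_bound: "\<bar>S k y\<bar> \<le> 2" for k y using S_diff[where a=0] S0 by simp
  have geo: "summable (\<lambda>k. 2 * (1/2) ^ k :: real)" by (intro summable_mult summable_geometric) simp
  have S_le: "norm (S k y / 2 ^ k) \<le> 2 * (1/2) ^ k" for k y
    using S_bound[of k y] by (simp add: power_one_over divide_right_mono)
  have S_summable: "summable (\<lambda>k. S k y / 2 ^ k)" for y
    by (rule summable_comparison_test'[OF geo, of 0]) (rule S_le)
  define H where "H y = (\<Sum>k. S k y / 2 ^ k)" for y
  have S_cont: "continuous_on UNIV (S k)" for k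
    by (rule DERIV_continuous_on[where D = "s k"]) (rule has_field_derivative_at_within[OF S])
  have partial_cont: "continuous_on UNIV (\<lambda>y. \<Sum>k<n. S k y / 2 ^ k)" for n
    by (intro continuous_intros S_cont) simp
  have "uniform_limit UNIV (\<lambda>n y. \<Sum>k<n. S k y / 2 ^ k) H sequentially"
    unfolding H_def by (rule Weierstrass_m_test[OF S_le geo])
  then have "continuous_on UNIV H"
    by (rule uniform_limit_theorem[rotated]) (simp_all add: partial_cont)
  have H_deriv: "(H has_real_derivative (\<Sum>k. s k y / 2 ^ k)) (at y)" if yz: "y \<noteq> z" for y
  proof -
    obtain e N where "e > 0" and N: "\<And>k t. k \<ge> N \<Longrightarrow> \<bar>t - y\<bar> < e \<Longrightarrow> s k t = 0"
      using locfin[OF yz] by blast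
    have const: "S k t = S k y" if "k \<ge> N" "\<bar>t - y\<bar> < e" for k t
    proof -
      have "((\<lambda>x. 0) has_integral 0) {min t y..max t y}" by simp
      then have zero: "(s k has_integral 0) {min t y..max t y}"
        by (rule has_integral_eq[rotated]) (use N that in auto)
      have "min t y \<le> max t y" by simp
      then have "S k (max t y) - S k (min t y) = 0"
        by (rule has_integral_unique[OF S_int zero])
      then show ?thesis by (auto simp: max_def min_def split: if_splits)
    qed
    \<comment> \<open>Near y the terms from N on do not vary, so that their sum is a constant c.\<close>
    define c where "c = (\<Sum>k. S (k + N) y / 2 ^ (k + N))"
    have H_eq: "c + (\<Sum>k<N. S k t / 2 ^ k) = H t" if "\<bar>t - y\<bar> < e" for t
    proof -
      have "(\<Sum>k. S (k + N) t / 2 ^ (k + N)) = c"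
        unfolding c_def using const[OF _ that] by simp
      then show ?thesis
        unfolding H_def using suminf_split_initial_segment[OF S_summable, of t N] by simp
    qed
    have "((\<lambda>t. c + (\<Sum>k<N. S k t / 2 ^ k)) has_real_derivative 0 + (\<Sum>k<N. s k y / 2 ^ k)) (at y)"
      by (intro DERIV_add DERIV_const DERIV_sum DERIV_cdivide S)
    then have "(H has_real_derivative 0 + (\<Sum>k<N. s k y / 2 ^ k)) (at y)"
      by (rule has_field_derivative_transform_within[OF _ \<open>e > 0\<close>])
        (use H_eq in \<open>auto simp: dist_real_def\<close>)
    moreover have "(\<Sum>k. s k y / 2 ^ k) = (\<Sum>k<N. s k y / 2 ^ k)"
      by (rule suminf_finite) (use N \<open>e > 0\<close> in auto)
    ultimately show ?thesis by simp
  qed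
  have H_int: "((\<lambda>y. \<Sum>k. s k y / 2 ^ k) has_integral H b - H a) {a..b}" if "a \<le> b" for a b
    by (rule fundamental_theorem_of_calculus_interior_strong[of "{z}"])
      (use that H_deriv continuous_on_subset[OF \<open>continuous_on UNIV H\<close>] in
        \<open>auto simp flip: has_real_derivative_iff_has_vector_derivative\<close>)
  have "\<exists>B. \<forall>u v. u \<le> v \<and> (B \<le> u \<or> v \<le> - B) \<longrightarrow> \<bar>integral {u..v} (\<lambda>y. \<Sum>k. s k y / 2 ^ k)\<bar> \<le> \<epsilon>"
    if "\<epsilon> > 0" for \<epsilon>
  proof -
    obtain N where N: "(1/2::real) ^ N < \<epsilon> / 4"
      using real_arch_pow_inv[of "\<epsilon>/4" "1/2"] \<open>\<epsilon> > 0\<close> by auto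
    have "bounded (\<Union>k<N. {y. s k y \<noteq> 0})" using supp by auto
    then obtain B where B: "\<And>k y. k < N \<Longrightarrow> s k y \<noteq> 0 \<Longrightarrow> \<bar>y\<bar> \<le> B"
      unfolding bounded_iff by auto
    have "\<bar>H v - H u\<bar> \<le> \<epsilon>" if "u \<le> v" "B + 1 \<le> u \<or> v \<le> - (B + 1)" for u v
    proof -
      define f where "f k = S k v / 2 ^ k - S k u / 2 ^ k" for k
      have f_sum: "summable f" unfolding f_def by (intro summable_diff S_summable)
      have "f k = 0" if "k < N" for k
      proof -
        have "((\<lambda>x. 0) has_integral 0) {u..v}" by simp
        then have zero: "(s k has_integral 0) {u..v}"
          by (rule has_integral_eq[rotated])
            (use B[OF that] \<open>B + 1 \<le> u \<or> v \<le> - (B + 1)\<close> in force)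
        have "S k v - S k u = 0"
          by (rule has_integral_unique[OF S_int[OF \<open>u \<le> v\<close>] zero])
        then show ?thesis by (simp add: f_def)
      qed
      then have "suminf f = (\<Sum>k. f (k + N))"
        using suminf_split_initial_segment[OF f_sum, of N] by simp
      moreover have "norm (f (k + N)) \<le> 2 * (1/2) ^ N * (1/2) ^ k" for k
      proof -
        have "\<bar>f (k + N)\<bar> = \<bar>S (k + N) v - S (k + N) u\<bar> * (1/2) ^ (k + N)"
          unfolding f_def by (simp add: power_one_over flip: diff_divide_distrib)
        also have "\<dots> \<le> 2 * (1/2) ^ (k + N)" by (intro mult_right_mono S_diff) simp
        finally show ?thesis by (simp add: power_add mult_ac)
      qed
      moreover have "(\<lambda>k. 2 * (1/2) ^ N * (1/2) ^ k :: real) sums (2 * (1/2) ^ N * (1 / (1 - 1/2)))"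
        by (intro sums_mult geometric_sums) simp
      ultimately have "\<bar>suminf f\<bar> \<le> 2 * (1/2) ^ N * (1 / (1 - 1/2))"
        using norm_suminf_le[of "\<lambda>k. f (k + N)" "\<lambda>k. 2 * (1/2) ^ N * (1/2) ^ k"]
        by (simp add: sums_iff)
      moreover have "suminf f = H v - H u"
        unfolding f_def H_def by (rule suminf_diff[symmetric]) (rule S_summable)+
      ultimately show ?thesis using N by simp
    qed
    then have "\<bar>integral {u..v} (\<lambda>y. \<Sum>k. s k y / 2 ^ k)\<bar> \<le> \<epsilon>"
      if "u \<le> v" "B + 1 \<le> u \<or> v \<le> - (B + 1)" for u v
      using integral_unique[OF H_int] that by metis
    then show ?thesis by blast
  qed
  moreover have "(\<lambda>y. \<Sum>k. s k y / 2 ^ k) integrable_on {a..b}" for a b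
    using H_int[of a b] by (cases "a \<le> b") (auto simp: integrable_on_empty)
  ultimately show ?thesis unfolding HK_iff_Cauchy_tails by blast
qed

lemma bounded_support_times_absolutely_integrable:
  fixes s \<phi> :: "real \<Rightarrow> real"
  assumes "s \<in> borel_measurable borel" "bounded (range s)" "\<And>y. s y \<noteq> 0 \<Longrightarrow> y \<in> {a..b}"
    and "\<phi> absolutely_integrable_on {a..b}"
  shows "(\<lambda>y. s y * \<phi> y) absolutely_integrable_on UNIV"
proof -
  have "s \<in> borel_measurable (lebesgue_on {a..b})"
    using assms(1) by (intro measurable_restrict_space1) (simp add: measurable_completion)
  moreover have "bounded (s ` {a..b})" using assms(2) by (rule bounded_subset) auto
  ultimately have "(\<lambda>y. s y * \<phi> y) absolutely_integrable_on {a..b}"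
    using assms(4) by (intro absolutely_integrable_bounded_measurable_product_real) auto
  then have "(\<lambda>y. if y \<in> {a..b} then s y * \<phi> y else 0) absolutely_integrable_on UNIV"
    by (simp only: absolutely_integrable_restrict_UNIV)
  moreover have "(\<lambda>y. if y \<in> {a..b} then s y * \<phi> y else 0) = (\<lambda>y. s y * \<phi> y)"
    by (rule ext) (use assms(3) in force)
  ultimately show ?thesis by simp
qed

lemma test_function_supportE:
  assumes "test_function A s"
  obtains R where "R > 0" "\<And>y. s y \<noteq> 0 \<Longrightarrow> \<bar>y\<bar> \<le> R"
proof -
  have "bounded {y. s y \<noteq> 0}" using assms by (simp add: test_function_def)
  then obtain R where "R > 0" "\<forall>y\<in>{y. s y \<noteq> 0}. norm y \<le> R" unfolding bounded_pos by blast
  then show ?thesis by (intro that[of R]) auto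
qed

lemma test_function_times_absolutely_integrable:
  fixes \<phi> :: "real \<Rightarrow> real"
  assumes "test_function A s" "\<And>a b. \<phi> absolutely_integrable_on {a..b}"
  shows "(\<lambda>y. s y * \<phi> y) absolutely_integrable_on UNIV"
proof -
  obtain R where R: "\<And>y. s y \<noteq> 0 \<Longrightarrow> \<bar>y\<bar> \<le> R" using test_function_supportE[OF assms(1)] by metis
  show ?thesis
    by (rule bounded_support_times_absolutely_integrable[of _ "-R" R])
      (use assms R in \<open>auto simp: test_function_def abs_le_iff minus_le_iff\<close>)
qed

text \<open>
  The humps have to be continuous for their sum to have a classical primitive, and compactly supported in A to leave
  room for the next one. A measurable function is almost everywhere a limit of continuous ones. Truncating these at the bound C of s
  and multiplying them by cutoffs gives approximations with the required support, and dominated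
  convergence controls both pairings at once through the weight 1 + \<open>\<bar>\<phi>\<bar>\<close>.
\<close>

lemma test_function_continuous_approx:
  fixes \<phi> :: "real \<Rightarrow> real"
  assumes s: "test_function A s" and "open A" and int: "\<And>a b. \<phi> absolutely_integrable_on {a..b}"
    and "\<epsilon> > 0"
  obtains s' K where "continuous_on UNIV s'" "compact K" "K \<subseteq> A" "\<And>y. y \<notin> K \<Longrightarrow> s' y = 0"
    "\<And>a b. \<bar>integral {a..b} s'\<bar> \<le> 1 + \<epsilon>"
    "\<bar>integral UNIV (\<lambda>y. s' y * \<phi> y) - integral UNIV (\<lambda>y. s y * \<phi> y)\<bar> \<le> \<epsilon>"
proof -
  obtain R where "R > 0" and R: "\<And>y. s y \<noteq> 0 \<Longrightarrow> \<bar>y\<bar> \<le> R"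
    using test_function_supportE[OF s] by metis
  obtain C where "C > 0" and C: "\<And>y. \<bar>s y\<bar> \<le> C"
    using s unfolding test_function_def bounded_pos by auto
  have s_meas: "s \<in> borel_measurable borel" and s_A: "\<And>y. s y \<noteq> 0 \<Longrightarrow> y \<in> A"
    and s_norm: "\<And>a b. \<bar>integral {a..b} s\<bar> \<le> 1"
    using s unfolding test_function_def by auto
  have "s measurable_on UNIV"
    using s_meas by (intro lebesgue_measurable_imp_measurable_on) (auto simp: measurable_completion)
  then obtain Z g where "negligible Z" and g_cont: "\<And>n. continuous_on UNIV (g n)"
    and g_lim: "\<And>y. y \<notin> Z \<Longrightarrow> (\<lambda>n. g n y) \<longlonglongrightarrow> s y"
    unfolding measurable_on_def by auto
  \<comment> \<open>The bounded interval makes the cutoffs compactly supported and F nonempty, as distances to F require.\<close>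
  define F where "F = - (A \<inter> {-R-1<..<R+1})"
  have "closed F" unfolding F_def using \<open>open A\<close> by (intro closed_Compl open_Int open_greaterThanLessThan)
  have "F \<noteq> {}" unfolding F_def using \<open>R > 0\<close> by (auto intro!: exI[of _ "R + 1"])
  define cut where "cut n y = max 0 (min 1 (real n * infdist y F - 1))" for n y
  define s' where "s' n y = max (- C) (min C (g n y)) * cut n y" for n y
  define K where "K n = {y. 1 / real n \<le> infdist y F}" for n
  have cut_bounds: "0 \<le> cut n y" "cut n y \<le> 1" for n y by (auto simp: cut_def)
  have F0: "cut n y = 0" if "y \<in> F" for n y
    using that by (simp add: cut_def)
  have s'_cont: "continuous_on UNIV (s' n)" for n
    unfolding s'_def cut_def by (intro continuous_intros g_cont)
  have s'_bound: "\<bar>s' n y\<bar> \<le> C" for n y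
  proof -
    have "\<bar>max (- C) (min C (g n y))\<bar> * \<bar>cut n y\<bar> \<le> C * 1"
      using \<open>C > 0\<close> cut_bounds by (intro mult_mono) auto
    then show ?thesis by (simp add: s'_def abs_mult)
  qed
  have s'_supp: "y \<in> {-R-1..R+1}" if "s' n y \<noteq> 0" for n y
  proof -
    have "y \<notin> F" using that F0 by (auto simp: s'_def)
    then show ?thesis by (auto simp: F_def)
  qed
  have K_compact: "compact (K n)" "K n \<subseteq> A" if "n > 0" for n
  proof -
    have "K n \<inter> F = {}" using that by (auto simp: K_def)
    then have sub: "K n \<subseteq> A \<inter> {-R-1<..<R+1}" by (auto simp: F_def)
    then show "K n \<subseteq> A" by blast
    have "closed (K n)" unfolding K_def by (intro closed_Collect_le continuous_intros)
    moreover have "bounded (K n)" using sub bounded_subset[of "{-R-1..R+1}" "K n"] by force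
    ultimately show "compact (K n)" by (simp add: compact_eq_bounded_closed)
  qed
  have K_zero: "s' n y = 0" if "n > 0" "y \<notin> K n" for n y
  proof -
    have "real n * infdist y F < 1" using that by (simp add: K_def field_simps)
    then show ?thesis by (simp add: s'_def cut_def)
  qed
  have s'_lim: "(\<lambda>n. s' n y) \<longlonglongrightarrow> s y" if "y \<notin> Z" for y
  proof (cases "y \<in> F")
    case True
    then have "s y = 0" using s_A R by (auto simp: F_def) (smt (verit))+
    then show ?thesis using F0[OF True] by (simp add: s'_def)
  next
    case False
    then have pos: "infdist y F > 0"
      using \<open>closed F\<close> \<open>F \<noteq> {}\<close> in_closed_iff_infdist_zero infdist_nonneg by (metis order_le_less)
    obtain N where N: "2 < real N * infdist y F" using reals_Archimedean3[OF pos] by blast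
    have "cut n y = 1" if "n \<ge> N" for n
    proof -
      have "real N * infdist y F \<le> real n * infdist y F" using that pos by simp
      then show ?thesis using N by (simp add: cut_def)
    qed
    then have "(\<lambda>n. cut n y) \<longlonglongrightarrow> 1" by (intro tendsto_eventually) (auto simp: eventually_sequentially)
    moreover have "(\<lambda>n. max (- C) (min C (g n y))) \<longlonglongrightarrow> max (- C) (min C (s y))"
      by (intro tendsto_intros g_lim that)
    ultimately have "(\<lambda>n. s' n y) \<longlonglongrightarrow> max (- C) (min C (s y)) * 1"
      unfolding s'_def by (intro tendsto_mult)
    then show ?thesis using C[of y] by (simp add: abs_le_iff minus_le_iff max_def min_def split: if_splits)
  qed
  define \<psi> where "\<psi> y = 1 + \<bar>\<phi> y\<bar>" for y
  have \<psi>: "\<psi> absolutely_integrable_on {a..b}" for a b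
    unfolding \<psi>_def using int[of a b] absolutely_integrable_on_const[of "{a..b}" "1::real"]
      absolutely_integrable_norm[OF int[of a b]] by (intro set_integral_add) (auto simp: comp_def)
  define d where "d n y = \<bar>s' n y - s y\<bar> * \<psi> y" for n y
  have d_meas: "(\<lambda>y. \<bar>s' n y - s y\<bar>) \<in> borel_measurable borel" for n
    using borel_measurable_continuous_onI[OF s'_cont[of n]] s_meas by measurable
  have d_le: "\<bar>s' n y - s y\<bar> \<le> 2 * C" for n y
    using s'_bound[of n y] C[of y] by linarith
  have diff_supp: "y \<in> {-R-1..R+1}" if "s' n y - s y \<noteq> 0" for n y
  proof (cases "s' n y = 0")
    case True
    then show ?thesis using R[of y] that by auto
  qed (use s'_supp in auto)
  have d_int: "d n integrable_on UNIV" for n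
  proof -
    have "(\<lambda>y. \<bar>s' n y - s y\<bar> * \<psi> y) absolutely_integrable_on UNIV"
    proof (rule bounded_support_times_absolutely_integrable[OF d_meas])
      show "bounded (range (\<lambda>y. \<bar>s' n y - s y\<bar>))" using d_le by (intro boundedI) auto
      show "y \<in> {-R-1..R+1}" if "\<bar>s' n y - s y\<bar> \<noteq> 0" for y
        using diff_supp[of n y] that by simp
    qed (rule \<psi>)
    then show ?thesis unfolding d_def by (simp add: absolutely_integrable_on_def)
  qed
  have "(\<lambda>n. integral {-R-1..R+1} (\<lambda>y. if y \<in> Z then 0 else d n y)) \<longlonglongrightarrow> integral {-R-1..R+1} (\<lambda>y. 0)"
  proof (rule dominated_convergence(2))
    show "(\<lambda>y. if y \<in> Z then 0 else d n y) integrable_on {-R-1..R+1}" for n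
      by (rule integrable_spike[OF integrable_on_subinterval[OF d_int] \<open>negligible Z\<close>]) auto
    show "(\<lambda>y. 2 * C * \<psi> y) integrable_on {-R-1..R+1}"
      using \<psi> by (intro integrable_on_mult_right) (simp add: absolutely_integrable_on_def)
    show "norm (if y \<in> Z then 0 else d n y) \<le> 2 * C * \<psi> y" for n y
      using d_le[of n y] \<open>C > 0\<close> by (auto simp: d_def \<psi>_def abs_mult intro!: mult_right_mono)
    show "(\<lambda>n. if y \<in> Z then 0 else d n y) \<longlonglongrightarrow> 0" for y
    proof (cases "y \<in> Z")
      case False
      have "(\<lambda>n. \<bar>s' n y - s y\<bar> * \<psi> y) \<longlonglongrightarrow> \<bar>s y - s y\<bar> * \<psi> y"
        by (intro tendsto_intros s'_lim False)
      then show ?thesis using False by (simp add: d_def)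
    qed simp
  qed
  then have "\<forall>\<^sub>F n in sequentially. integral {-R-1..R+1} (\<lambda>y. if y \<in> Z then 0 else d n y) < \<epsilon>"
    using \<open>\<epsilon> > 0\<close> by (intro order_tendstoD) auto
  then obtain n where "n > 0" and n: "integral {-R-1..R+1} (\<lambda>y. if y \<in> Z then 0 else d n y) < \<epsilon>"
    using eventually_gt_at_top[of 0] eventually_happens[OF eventually_conj] by (metis (no_types, lifting) sequentially_bot)
  have "integral UNIV (d n) = integral {-R-1..R+1} (d n)"
  proof -
    have "(\<lambda>y. if y \<in> {-R-1..R+1} then d n y else 0) = d n"
      by (rule ext) (use diff_supp[of n] in \<open>force simp: d_def\<close>)
    then show ?thesis by (metis integral_restrict_UNIV)
  qed
  also have "\<dots> = integral {-R-1..R+1} (\<lambda>y. if y \<in> Z then 0 else d n y)"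
    by (rule integral_spike[OF \<open>negligible Z\<close>]) auto
  finally have d_small: "integral UNIV (d n) \<le> \<epsilon>" using n by simp
  have d_nonneg: "0 \<le> d n y" for y by (simp add: d_def \<psi>_def)
  have range: "bounded (range (\<lambda>y. s' n y - s y))" using d_le by (intro boundedI) auto
  have diff_meas: "(\<lambda>y. s' n y - s y) \<in> borel_measurable borel"
    using borel_measurable_continuous_onI[OF s'_cont[of n]] s_meas by measurable
  have one: "(\<lambda>y::real. 1::real) absolutely_integrable_on {a..b}" for a b
    by (intro absolutely_integrable_continuous_real continuous_intros)
  have s_int: "(\<lambda>y. s y * \<phi> y) integrable_on UNIV" "s integrable_on UNIV"
    using test_function_times_absolutely_integrable[OF s int]
      test_function_times_absolutely_integrable[OF s one] by (simp_all add: absolutely_integrable_on_def)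
  have diff_int: "(\<lambda>y. (s' n y - s y) * \<phi> y) integrable_on UNIV" "(\<lambda>y. s' n y - s y) integrable_on UNIV"
    using bounded_support_times_absolutely_integrable[OF diff_meas range diff_supp int]
      bounded_support_times_absolutely_integrable[OF diff_meas range diff_supp one]
    by (simp_all add: absolutely_integrable_on_def)
  have "\<bar>integral UNIV (\<lambda>y. s' n y * \<phi> y) - integral UNIV (\<lambda>y. s y * \<phi> y)\<bar> \<le> \<epsilon>"
  proof -
    have "integral UNIV (\<lambda>y. s' n y * \<phi> y) = integral UNIV (\<lambda>y. (s' n y - s y) * \<phi> y + s y * \<phi> y)"
      by (simp add: algebra_simps)
    also have "\<dots> = integral UNIV (\<lambda>y. (s' n y - s y) * \<phi> y) + integral UNIV (\<lambda>y. s y * \<phi> y)"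
      by (intro integral_add diff_int s_int)
    moreover have "norm (integral UNIV (\<lambda>y. (s' n y - s y) * \<phi> y)) \<le> integral UNIV (d n)"
      by (rule integral_norm_bound_integral[OF diff_int(1) d_int])
        (auto simp: d_def \<psi>_def abs_mult intro!: mult_left_mono)
    ultimately show ?thesis using d_small by simp
  qed
  moreover have "\<bar>integral {a..b} (s' n)\<bar> \<le> 1 + \<epsilon>" for a b
  proof -
    have "integral {a..b} (s' n) = integral {a..b} (\<lambda>y. (s' n y - s y) + s y)" by simp
    also have "\<dots> = integral {a..b} (\<lambda>y. s' n y - s y) + integral {a..b} s"
      by (intro integral_add integrable_on_subinterval[OF diff_int(2)] integrable_on_subinterval[OF s_int(2)]) auto
    moreover have "norm (integral {a..b} (\<lambda>y. s' n y - s y)) \<le> integral {a..b} (d n)"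
    proof (rule integral_norm_bound_integral)
      fix y
      show "norm (s' n y - s y) \<le> d n y"
        using mult_left_mono[of 1 "\<psi> y" "\<bar>s' n y - s y\<bar>"] by (simp add: d_def \<psi>_def)
    qed (auto intro: integrable_on_subinterval[OF diff_int(2)] integrable_on_subinterval[OF d_int])
    moreover have "integral {a..b} (d n) \<le> integral UNIV (d n)"
      by (rule integral_subset_le) (auto intro: integrable_on_subinterval[OF d_int] d_int d_nonneg)
    ultimately show ?thesis using d_small s_norm[of a b] by simp
  qed
  ultimately show ?thesis
    using that[of "s' n" "K n"] s'_cont K_compact[OF \<open>n > 0\<close>] K_zero[OF \<open>n > 0\<close>] by blast
qed

section \<open>Uniform boundedness by a gliding hump\<close>

definition uniformly_bounded_on :: "(real \<Rightarrow> real \<Rightarrow> real) \<Rightarrow> real set \<Rightarrow> bool" where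
  "uniformly_bounded_on g A \<longleftrightarrow> (\<exists>\<delta>>0. \<exists>K. \<forall>x s. x \<noteq> 0 \<and> \<bar>x\<bar> < \<delta> \<and> test_function A s \<longrightarrow>
     \<bar>integral UNIV (\<lambda>y. s y * g x y)\<bar> \<le> K)"

lemma compact_subset_of_interval:
  fixes A :: "real set"
  assumes "compact K" "K \<subseteq> A" "is_interval A"
  obtains c d where "K \<subseteq> {c..d}" "{c..d} \<subseteq> A"
proof (cases "K = {}")
  case True
  then show ?thesis by (intro that[of 1 0]) auto
next
  case False
  then obtain c d where "c \<in> K" "d \<in> K" "\<And>y. y \<in> K \<Longrightarrow> c \<le> y \<and> y \<le> d"
    using compact_attains_inf[OF assms(1)] compact_attains_sup[OF assms(1)] by metis
  moreover have "{c..d} \<subseteq> A"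
    using calculation(1,2) assms(2,3) unfolding is_interval_1 by (meson atLeastAtMost_iff subsetD subsetI)
  ultimately show ?thesis by (intro that[of c d]) auto
qed

lemma compact_eventually_disjoint:
  fixes A :: "nat \<Rightarrow> real set"
  assumes "compact K" "decseq A"
    and "\<And>y. y \<in> K \<Longrightarrow> \<exists>e>0. \<exists>N. \<forall>t. \<bar>t - y\<bar> < e \<longrightarrow> t \<notin> A N"
  shows "\<exists>N. A N \<inter> K = {}"
proof (rule ccontr)
  assume "\<nexists>N. A N \<inter> K = {}"
  then have "\<forall>n. \<exists>t. t \<in> A n \<and> t \<in> K" by blast
  then obtain t where t: "\<And>n. t n \<in> A n" "\<And>n. t n \<in> K" by metis
  then obtain y r where "y \<in> K" "strict_mono r" and lim: "(t \<circ> r) \<longlonglongrightarrow> y"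
    using \<open>compact K\<close> unfolding compact_def by meson
  obtain e N where "e > 0" and N: "\<And>u. \<bar>u - y\<bar> < e \<Longrightarrow> u \<notin> A N" using assms(3)[OF \<open>y \<in> K\<close>] by blast
  have "\<forall>\<^sub>F n in sequentially. dist ((t \<circ> r) n) y < e" using lim \<open>e > 0\<close> by (rule tendstoD)
  then obtain n where "n \<ge> N" "dist (t (r n)) y < e"
    unfolding eventually_sequentially comp_def by (meson nat_le_linear)
  moreover have "N \<le> r n" using \<open>n \<ge> N\<close> seq_suble[OF \<open>strict_mono r\<close>, of n] by linarith
  then have "A (r n) \<subseteq> A N" by (rule decseqD[OF \<open>decseq A\<close>])
  ultimately show False using N t(1)[of "r n"] by (auto simp: dist_real_def)
qed

text \<open>
  The sets A n shrink to one point z or escape to infinity; in the latter case z only has to avoid the sets.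
  If no set A n is good, a hump supported in a compact part of some A n is chosen, then a later set A m disjoint
  from that part, and so on. The supports are disjoint intervals, so the integral of h (g_{x_k} - 1) over the k-th one involves the
  k-th hump alone, and no cross terms have to be estimated.
\<close>

lemma gliding_hump:
  fixes g :: "real \<Rightarrow> real \<Rightarrow> real" and A :: "nat \<Rightarrow> real set"
  assumes conv: "\<And>h. h \<in> HK \<Longrightarrow> \<forall>\<^sub>F x in at 0. \<forall>a b. \<bar>integral {a..b} (\<lambda>y. h y * (g x y - 1))\<bar> \<le> 1"
    and "\<delta>0 > 0" and int: "\<And>x a b. x \<noteq> 0 \<Longrightarrow> \<bar>x\<bar> < \<delta>0 \<Longrightarrow> g x absolutely_integrable_on {a..b}"
    and A: "\<And>n. open (A n)" "\<And>n. is_interval (A n)" "decseq A" "\<And>n. z \<notin> A n"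
    and locfin: "\<And>y. y \<noteq> z \<Longrightarrow> \<exists>e>0. \<exists>N. \<forall>t. \<bar>t - y\<bar> < e \<longrightarrow> t \<notin> A N"
  shows "\<exists>n. uniformly_bounded_on g (A n)"
proof (rule ccontr)
  assume "\<nexists>n. uniformly_bounded_on g (A n)"
  then have unbdd: "\<not> uniformly_bounded_on g (A n)" for n by blast
  \<comment> \<open>Admissible k-th hump s in A n, carried by [c, d], with parameter x. The bound 4 * 2^k survives the weight 1 / 2^k:
  it exceeds the bound 1 from the hypothesis plus the norm 2 of the hump.\<close>
  define Q where "Q = (\<lambda>k (n, x, s, c, d). x \<noteq> 0 \<and> \<bar>x\<bar> < \<delta>0 \<and> \<bar>x\<bar> < 1 / real (Suc k) \<and>
    continuous_on UNIV s \<and> {c..d} \<subseteq> A n \<and> (\<forall>y. y \<notin> {c..d} \<longrightarrow> s y = 0) \<and>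
    (\<forall>a b. \<bar>integral {a..b} s\<bar> \<le> 2) \<and> 4 * 2 ^ k < \<bar>integral UNIV (\<lambda>y. s y * g x y)\<bar>)"
  have Q_ex: "\<exists>x s c d. Q k (n, x, s, c, d)" for k n
  proof -
    have "min \<delta>0 (1 / real (Suc k)) > 0" using \<open>\<delta>0 > 0\<close> by simp
    then have "\<not> (\<forall>x s. x \<noteq> 0 \<and> \<bar>x\<bar> < min \<delta>0 (1 / real (Suc k)) \<and> test_function (A n) s \<longrightarrow>
        \<bar>integral UNIV (\<lambda>y. s y * g x y)\<bar> \<le> 4 * 2 ^ k + 1)"
      using unbdd[of n] unfolding uniformly_bounded_on_def by blast
    then obtain x s where xs: "x \<noteq> 0" "\<bar>x\<bar> < min \<delta>0 (1 / real (Suc k))" "test_function (A n) s"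
      "4 * 2 ^ k + 1 < \<bar>integral UNIV (\<lambda>y. s y * g x y)\<bar>"
      unfolding not_all not_imp not_le by blast
    have gx: "g x absolutely_integrable_on {a..b}" for a b using xs int by simp
    obtain s' K where s': "continuous_on UNIV s'" "compact K" "K \<subseteq> A n" "\<And>y. y \<notin> K \<Longrightarrow> s' y = 0"
      "\<And>a b. \<bar>integral {a..b} s'\<bar> \<le> 1 + 1"
      "\<bar>integral UNIV (\<lambda>y. s' y * g x y) - integral UNIV (\<lambda>y. s y * g x y)\<bar> \<le> 1"
      by (rule test_function_continuous_approx[OF xs(3) A(1) gx zero_less_one]) (rule that)
    obtain c d where "K \<subseteq> {c..d}" "{c..d} \<subseteq> A n"
      using compact_subset_of_interval[OF s'(2,3) A(2)] by metis
    then have "Q k (n, x, s', c, d)"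
      unfolding Q_def prod.case using xs s' by (auto simp: subset_iff)
    then show ?thesis by blast
  qed
  define next' where "next' = (\<lambda>(n, x :: real, s :: real \<Rightarrow> real, c :: real, d :: real)
    (n', x' :: real, s' :: real \<Rightarrow> real, c' :: real, d' :: real). n < n' \<and> A n' \<inter> {c..d} = {})"
  have "\<exists>f. \<forall>k. Q k (f k) \<and> next' (f k) (f (Suc k))"
  proof (rule dependent_nat_choice)
    show "\<exists>p. Q 0 p" using Q_ex by blast
    fix p k assume "Q k p"
    obtain n x s c d where p: "p = (n, x, s, c, d)" by (cases p) auto
    have "{c..d} \<subseteq> A n" using \<open>Q k p\<close> by (simp add: Q_def p)
    then have "\<exists>N. A N \<inter> {c..d} = {}"
      using A(4) by (intro compact_eventually_disjoint A(3) locfin) auto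
    then obtain N where N: "A N \<inter> {c..d} = {}" ..
    define n' where "n' = max (Suc n) N"
    have "A n' \<inter> {c..d} = {}" using N decseqD[OF A(3), of N n'] by (auto simp: n'_def)
    moreover obtain x' s' c' d' where "Q (Suc k) (n', x', s', c', d')" using Q_ex by blast
    ultimately show "\<exists>q. Q (Suc k) q \<and> next' p q"
      by (intro exI[of _ "(n', x', s', c', d')"]) (auto simp: next'_def p n'_def)
  qed
  then obtain f where fQ: "\<And>k. Q k (f k)" and fnext: "\<And>k. next' (f k) (f (Suc k))" by blast
  define N x s c d where "N k = fst (f k)" "x k = fst (snd (f k))" "s k = fst (snd (snd (f k)))"
    "c k = fst (snd (snd (snd (f k))))" "d k = snd (snd (snd (snd (f k))))" for k
  have f_eq: "f k = (N k, x k, s k, c k, d k)" for k by (simp add: N_x_s_c_d_def)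
  have x: "x k \<noteq> 0" "\<bar>x k\<bar> < \<delta>0" "\<bar>x k\<bar> < 1 / real (Suc k)"
    and s: "continuous_on UNIV (s k)" "\<And>y. y \<notin> {c k..d k} \<Longrightarrow> s k y = 0" "\<And>a b. \<bar>integral {a..b} (s k)\<bar> \<le> 2"
    and cd: "{c k..d k} \<subseteq> A (N k)"
    and big: "4 * 2 ^ k < \<bar>integral UNIV (\<lambda>y. s k y * g (x k) y)\<bar>" for k
    using fQ[of k] unfolding Q_def f_eq prod.case by blast+
  have N_less: "N k < N (Suc k)" and disj: "A (N (Suc k)) \<inter> {c k..d k} = {}" for k
    using fnext[of k] unfolding next'_def f_eq prod.case by blast+
  have "strict_mono N" using N_less by (simp add: strict_mono_Suc_iff)
  have disjoint: "{c j..d j} \<inter> {c k..d k} = {}" if "j < k" for j k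
  proof -
    have "N (Suc j) \<le> N k" using \<open>strict_mono N\<close> that by (simp add: strict_mono_less_eq)
    then have "A (N k) \<subseteq> A (N (Suc j))" using A(3) by (rule decseqD[rotated])
    then show ?thesis using cd[of k] disj[of j] by blast
  qed
  define h where "h y = (\<Sum>k. s k y / 2 ^ k)" for y
  have "h \<in> HK"
    unfolding h_def
  proof (rule disjoint_humps_HK[where z = z])
    show "bounded {y. s k y \<noteq> 0}" for k
      by (rule bounded_subset[of "{c k..d k}"]) (simp, use s(2) in blast)
    fix y assume "y \<noteq> z"
    then obtain e M where "e > 0" and M: "\<And>t. \<bar>t - y\<bar> < e \<Longrightarrow> t \<notin> A M" using locfin by blast
    have "s k t = 0" if "k \<ge> M" "\<bar>t - y\<bar> < e" for k t
    proof -
      have "M \<le> N k" using seq_suble[OF \<open>strict_mono N\<close>, of k] that by simp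
      then have "A (N k) \<subseteq> A M" using A(3) by (rule decseqD[rotated])
      then show ?thesis using M[OF that(2)] cd[of k] s(2)[of t k] by blast
    qed
    then show "\<exists>e>0. \<exists>M. \<forall>k\<ge>M. \<forall>t. \<bar>t - y\<bar> < e \<longrightarrow> s k t = 0" using \<open>e > 0\<close> by blast
  qed (rule s)+
  then obtain r where "r > 0" and r: "\<And>u a b. u \<noteq> 0 \<Longrightarrow> \<bar>u\<bar> < r \<Longrightarrow>
      \<bar>integral {a..b} (\<lambda>y. h y * (g u y - 1))\<bar> \<le> 1"
    using conv[OF \<open>h \<in> HK\<close>] unfolding eventually_at by (auto simp: dist_real_def)
  obtain k where "1 / real (Suc k) < r" using \<open>r > 0\<close> nat_approx_posE by blast
  then have "\<bar>x k\<bar> < r" using x(3)[of k] by linarith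
  let ?I = "{c k..d k}"
  have h_eq: "h y = s k y / 2 ^ k" if "y \<in> ?I" for y
  proof -
    have "s j y = 0" if "j \<noteq> k" for j
      using disjoint[of j k] disjoint[of k j] \<open>y \<in> ?I\<close> s(2)[of y j] that by (cases "j < k") (blast, force)
    then have "h y = (\<Sum>j\<in>{k}. s j y / 2 ^ j)" unfolding h_def by (intro suminf_finite) auto
    then show ?thesis by simp
  qed
  have sg_eq: "integral ?I (\<lambda>y. s k y * g (x k) y) = integral UNIV (\<lambda>y. s k y * g (x k) y)"
  proof -
    have "(\<lambda>y. if y \<in> ?I then s k y * g (x k) y else 0) = (\<lambda>y. s k y * g (x k) y)"
      by (rule ext) (use s(2)[of _ k] in force)
    then show ?thesis by (metis integral_restrict_UNIV)
  qed
  have s_int: "s k integrable_on ?I"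
    using continuous_on_subset[OF s(1)] by (intro integrable_continuous_interval) blast
  have "(\<lambda>y. s k y * g (x k) y) absolutely_integrable_on ?I"
  proof (rule absolutely_integrable_bounded_measurable_product_real)
    show "s k \<in> borel_measurable (lebesgue_on ?I)"
      using continuous_on_subset[OF s(1)] by (intro continuous_imp_measurable_on_sets_lebesgue) auto
    show "bounded (s k ` ?I)"
      using continuous_on_subset[OF s(1)] by (intro compact_imp_bounded compact_continuous_image) auto
  qed (use int x in auto)
  then have sg_int: "(\<lambda>y. s k y * g (x k) y) integrable_on ?I" by (simp add: absolutely_integrable_on_def)
  have "integral ?I (\<lambda>y. h y * (g (x k) y - 1)) = integral ?I (\<lambda>y. (s k y * g (x k) y - s k y) / 2 ^ k)"
    by (intro integral_cong) (simp add: h_eq field_simps)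
  also have "\<dots> = (integral ?I (\<lambda>y. s k y * g (x k) y) - integral ?I (s k)) / 2 ^ k"
    by (simp add: integral_diff[OF sg_int s_int])
  finally have "\<bar>integral UNIV (\<lambda>y. s k y * g (x k) y) - integral ?I (s k)\<bar> / 2 ^ k \<le> 1"
    using r[OF x(1)[of k] \<open>\<bar>x k\<bar> < r\<close>, of "c k" "d k"] by (simp add: sg_eq)
  then have "\<bar>integral UNIV (\<lambda>y. s k y * g (x k) y) - integral ?I (s k)\<bar> \<le> 2 ^ k"
    by (simp add: divide_le_eq)
  moreover have "(1::real) \<le> 2 ^ k" by simp
  ultimately show False using big[of k] s(3)[of "c k" "d k" k] by linarith
qed

lemma uniformly_bounded_on_subset:
  assumes "uniformly_bounded_on g B" "A \<subseteq> B"
  shows "uniformly_bounded_on g A"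
proof -
  have "test_function A s \<Longrightarrow> test_function B s" for s
    using assms(2) by (auto simp: test_function_def)
  then show ?thesis using assms(1) unfolding uniformly_bounded_on_def by metis
qed

lemma test_function_cut:
  assumes "test_function A s"
  shows "test_function (A \<inter> {..<b}) (\<lambda>y. if y < b then s y else 0)"
    and "test_function (A \<inter> {b<..}) (\<lambda>y. if y > b then s y else 0)"
proof -
  have s: "s \<in> borel_measurable borel" "bounded (range s)" "bounded {y. s y \<noteq> 0}" "{y. s y \<noteq> 0} \<subseteq> A"
    "\<And>a b. \<bar>integral {a..b} s\<bar> \<le> 1"
    using assms unfolding test_function_def by auto
  have l: "\<bar>integral {u..v} (\<lambda>y. if y < b then s y else 0)\<bar> \<le> 1" for u v
  proof -
    have "integral {u..v} (\<lambda>y. if y \<in> {..b} then s y else 0) = integral ({..b} \<inter> {u..v}) s"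
      by (rule integral_restrict_Int)
    moreover have "{..b} \<inter> {u..v} = {u..min b v}" by auto
    moreover have "integral {u..v} (\<lambda>y. if y < b then s y else 0) = integral {u..v} (\<lambda>y. if y \<in> {..b} then s y else 0)"
      by (rule integral_spike[of "{b}"]) auto
    ultimately show ?thesis using s(5) by simp
  qed
  have r: "\<bar>integral {u..v} (\<lambda>y. if y > b then s y else 0)\<bar> \<le> 1" for u v
  proof -
    have "integral {u..v} (\<lambda>y. if y \<in> {b..} then s y else 0) = integral ({b..} \<inter> {u..v}) s"
      by (rule integral_restrict_Int)
    moreover have "{b..} \<inter> {u..v} = {max b u..v}" by auto
    moreover have "integral {u..v} (\<lambda>y. if y > b then s y else 0) = integral {u..v} (\<lambda>y. if y \<in> {b..} then s y else 0)"
      by (rule integral_spike[of "{b}"]) auto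
    ultimately show ?thesis using s(5) by simp
  qed
  have sub: "range (\<lambda>y. if P y then s y else 0) \<subseteq> insert 0 (range s)"
    "{y. (if P y then s y else 0) \<noteq> 0} \<subseteq> {y. s y \<noteq> 0}" for P by auto
  have bdd: "bounded (range (\<lambda>y. if P y then s y else 0))" "bounded {y. (if P y then s y else 0) \<noteq> 0}" for P
    using bounded_subset[OF _ sub(1)] bounded_subset[OF s(3) sub(2)] s(2) by auto
  have meas: "(\<lambda>y. if y < b then s y else 0) \<in> borel_measurable borel"
    "(\<lambda>y. if y > b then s y else 0) \<in> borel_measurable borel"
    using s(1) by measurable
  show "test_function (A \<inter> {..<b}) (\<lambda>y. if y < b then s y else 0)"
    and "test_function (A \<inter> {b<..}) (\<lambda>y. if y > b then s y else 0)"
    unfolding test_function_def using meas bdd l r s(4) by (auto split: if_splits)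
qed

lemma uniformly_bounded_on_split:
  assumes "\<delta>0 > 0" and int: "\<And>x a b. x \<noteq> 0 \<Longrightarrow> \<bar>x\<bar> < \<delta>0 \<Longrightarrow> g x absolutely_integrable_on {a..b}"
    and "uniformly_bounded_on g (A \<inter> {..<b})" "uniformly_bounded_on g (A \<inter> {b<..})"
  shows "uniformly_bounded_on g A"
proof -
  obtain \<delta>1 K1 where 1: "\<delta>1 > 0" "\<And>x s. x \<noteq> 0 \<Longrightarrow> \<bar>x\<bar> < \<delta>1 \<Longrightarrow> test_function (A \<inter> {..<b}) s \<Longrightarrow>
     \<bar>integral UNIV (\<lambda>y. s y * g x y)\<bar> \<le> K1"
    using assms(3) unfolding uniformly_bounded_on_def by metis
  obtain \<delta>2 K2 where 2: "\<delta>2 > 0" "\<And>x s. x \<noteq> 0 \<Longrightarrow> \<bar>x\<bar> < \<delta>2 \<Longrightarrow> test_function (A \<inter> {b<..}) s \<Longrightarrow>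
     \<bar>integral UNIV (\<lambda>y. s y * g x y)\<bar> \<le> K2"
    using assms(4) unfolding uniformly_bounded_on_def by metis
  have "\<bar>integral UNIV (\<lambda>y. s y * g x y)\<bar> \<le> K1 + K2"
    if x: "x \<noteq> 0" "\<bar>x\<bar> < min \<delta>0 (min \<delta>1 \<delta>2)" and s: "test_function A s" for x s
  proof -
    let ?l = "\<lambda>y. if y < b then s y else 0" and ?r = "\<lambda>y. if y > b then s y else 0"
    have gx: "g x absolutely_integrable_on {a..b}" for a b using x int by simp
    have "(\<lambda>y. ?l y * g x y) integrable_on UNIV" "(\<lambda>y. ?r y * g x y) integrable_on UNIV"
      using test_function_cut[OF s] test_function_times_absolutely_integrable[OF _ gx]
      by (auto simp: absolutely_integrable_on_def)
    then have "integral UNIV (\<lambda>y. ?l y * g x y + ?r y * g x y) =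
        integral UNIV (\<lambda>y. ?l y * g x y) + integral UNIV (\<lambda>y. ?r y * g x y)"
      by (rule integral_add)
    moreover have "integral UNIV (\<lambda>y. s y * g x y) = integral UNIV (\<lambda>y. ?l y * g x y + ?r y * g x y)"
      by (rule integral_spike[of "{b}"]) auto
    moreover have "\<bar>integral UNIV (\<lambda>y. ?l y * g x y)\<bar> \<le> K1"
      using x by (intro 1(2) test_function_cut[OF s]) auto
    moreover have "\<bar>integral UNIV (\<lambda>y. ?r y * g x y)\<bar> \<le> K2"
      using x by (intro 2(2) test_function_cut[OF s]) auto
    ultimately show ?thesis by linarith
  qed
  then show ?thesis
    unfolding uniformly_bounded_on_def
    using assms(1) 1(1) 2(1) by (intro exI[of _ "min \<delta>0 (min \<delta>1 \<delta>2)"] conjI exI[of _ "K1 + K2"]) auto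
qed

text \<open>
  The gliding hump argument gives a good one-sided neighbourhood on each side of every point, and good
  neighbourhoods of both infinities. Compactness, in the form of the Bolzano bisection principle, joins them.
\<close>

lemma uniformly_bounded_on_UNIV:
  fixes g :: "real \<Rightarrow> real \<Rightarrow> real"
  assumes conv: "\<And>h. h \<in> HK \<Longrightarrow> \<forall>\<^sub>F x in at 0. \<forall>a b. \<bar>integral {a..b} (\<lambda>y. h y * (g x y - 1))\<bar> \<le> 1"
    and "\<delta>0 > 0" and int: "\<And>x a b. x \<noteq> 0 \<Longrightarrow> \<bar>x\<bar> < \<delta>0 \<Longrightarrow> g x absolutely_integrable_on {a..b}"
  shows "uniformly_bounded_on g UNIV"
proof -
  note hump = gliding_hump[OF conv \<open>\<delta>0 > 0\<close> int] and split = uniformly_bounded_on_split[OF \<open>\<delta>0 > 0\<close> int]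
  have small: "\<exists>N. 1 / real (Suc N) < e" if "e > 0" for e using that nat_approx_posE by metis
  have near: "\<not> (z < t \<and> t < z + r)" "\<not> (z - r < t \<and> t < z)"
    if "r < \<bar>y - z\<bar> / 2" "\<bar>t - y\<bar> < \<bar>y - z\<bar> / 2" for r t y z :: real
    using that by (auto simp: abs_if field_simps split: if_splits)
  have right: "\<exists>e>0. uniformly_bounded_on g {z<..<z + e}" for z
  proof -
    have "\<exists>n. uniformly_bounded_on g {z<..<z + 1 / real (Suc n)}"
    proof (rule hump[where z = z])
      show "decseq (\<lambda>n. {z<..<z + 1 / real (Suc n)})"
        by (intro decseq_SucI subsetI) (auto elim!: less_le_trans intro!: divide_left_mono)
      fix y assume "y \<noteq> z"
      then obtain N where "1 / real (Suc N) < \<bar>y - z\<bar> / 2" using small[of "\<bar>y - z\<bar> / 2"] by auto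
      then have "t \<notin> {z<..<z + 1 / real (Suc N)}" if "\<bar>t - y\<bar> < \<bar>y - z\<bar> / 2" for t
        using near that unfolding greaterThanLessThan_iff by blast
      then show "\<exists>e>0. \<exists>N. \<forall>t. \<bar>t - y\<bar> < e \<longrightarrow> t \<notin> {z<..<z + 1 / real (Suc N)}"
        using \<open>y \<noteq> z\<close> by (intro exI[of _ "\<bar>y - z\<bar> / 2"] conjI exI[of _ N]) auto
    qed auto
    then show ?thesis by (metis of_nat_0_less_iff zero_less_Suc zero_less_divide_1_iff)
  qed
  have left: "\<exists>e>0. uniformly_bounded_on g {z - e<..<z}" for z
  proof -
    have "\<exists>n. uniformly_bounded_on g {z - 1 / real (Suc n)<..<z}"
    proof (rule hump[where z = z])
      show "decseq (\<lambda>n. {z - 1 / real (Suc n)<..<z})"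
        by (intro decseq_SucI subsetI) (auto elim!: le_less_trans[rotated] intro!: divide_left_mono)
      fix y assume "y \<noteq> z"
      then obtain N where "1 / real (Suc N) < \<bar>y - z\<bar> / 2" using small[of "\<bar>y - z\<bar> / 2"] by auto
      then have "t \<notin> {z - 1 / real (Suc N)<..<z}" if "\<bar>t - y\<bar> < \<bar>y - z\<bar> / 2" for t
        using near that unfolding greaterThanLessThan_iff by blast
      then show "\<exists>e>0. \<exists>N. \<forall>t. \<bar>t - y\<bar> < e \<longrightarrow> t \<notin> {z - 1 / real (Suc N)<..<z}"
        using \<open>y \<noteq> z\<close> by (intro exI[of _ "\<bar>y - z\<bar> / 2"] conjI exI[of _ N]) auto
    qed auto
    then show ?thesis by (metis of_nat_0_less_iff zero_less_Suc zero_less_divide_1_iff)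
  qed
  have far: "\<exists>e>0. \<exists>N. \<forall>t. \<bar>t - y\<bar> < e \<longrightarrow> \<not> real N < \<bar>t\<bar>" for y
  proof -
    obtain N where "\<bar>y\<bar> + 1 < real N" using reals_Archimedean2 by blast
    then show ?thesis by (intro exI[of _ 1] conjI exI[of _ N]) auto
  qed
  have "\<exists>n. uniformly_bounded_on g {real n<..}"
  proof (rule hump[where z = 0])
    show "decseq (\<lambda>n. {real n<..})" by (intro decseq_SucI) auto
    show "\<exists>e>0. \<exists>N. \<forall>t. \<bar>t - y\<bar> < e \<longrightarrow> t \<notin> {real N<..}" for y
    proof -
      obtain e N where "e > 0" "\<And>t. \<bar>t - y\<bar> < e \<Longrightarrow> \<not> real N < \<bar>t\<bar>" using far[of y] by blast
      then show ?thesis by (intro exI[of _ e] conjI exI[of _ N]) force+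
    qed
  qed auto
  then obtain n1 where n1: "uniformly_bounded_on g {real n1<..}" ..
  have "\<exists>n. uniformly_bounded_on g {..<- real n}"
  proof (rule hump[where z = 0])
    show "decseq (\<lambda>n. {..<- real n})" by (intro decseq_SucI) auto
    show "\<exists>e>0. \<exists>N. \<forall>t. \<bar>t - y\<bar> < e \<longrightarrow> t \<notin> {..<- real N}" for y
    proof -
      obtain e N where "e > 0" "\<And>t. \<bar>t - y\<bar> < e \<Longrightarrow> \<not> real N < \<bar>t\<bar>" using far[of y] by blast
      then show ?thesis by (intro exI[of _ e] conjI exI[of _ N]) force+
    qed
  qed auto
  then obtain n2 where n2: "uniformly_bounded_on g {..<- real n2}" ..
  have "uniformly_bounded_on g {- real n2<..<real n1}"
  proof (rule Bolzano[of "- real n2" "real n1" "\<lambda>a b. uniformly_bounded_on g {a<..<b}"])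
    fix a b c assume "uniformly_bounded_on g {a<..<b}" "uniformly_bounded_on g {b<..<c}"
    then show "uniformly_bounded_on g {a<..<c}"
      by (intro split[where A = "{a<..<c}" and b = b]) (auto elim: uniformly_bounded_on_subset)
  next
    fix x
    obtain e1 where "e1 > 0" and e1: "uniformly_bounded_on g {x<..<x + e1}" using right by blast
    obtain e2 where "e2 > 0" and e2: "uniformly_bounded_on g {x - e2<..<x}" using left by blast
    have "uniformly_bounded_on g {a<..<b}" if "a \<le> x" "x \<le> b" "b - a < min e1 e2" for a b
    proof (rule split[where b = x])
      show "uniformly_bounded_on g ({a<..<b} \<inter> {..<x})"
        by (rule uniformly_bounded_on_subset[OF e2]) (use that in auto)
      show "uniformly_bounded_on g ({a<..<b} \<inter> {x<..})"
        by (rule uniformly_bounded_on_subset[OF e1]) (use that in auto)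
    qed
    then show "\<exists>d>0. \<forall>a b. a \<le> x \<and> x \<le> b \<and> b - a < d \<longrightarrow> uniformly_bounded_on g {a<..<b}"
      using \<open>e1 > 0\<close> \<open>e2 > 0\<close> by (intro exI[of _ "min e1 e2"]) auto
  qed auto
  then have "uniformly_bounded_on g {- real n2<..}"
  proof (intro split[where A = "{- real n2<..}" and b = "real n1"])
    show "uniformly_bounded_on g ({- real n2<..} \<inter> {real n1<..})"
      by (rule uniformly_bounded_on_subset[OF n1]) auto
  qed (auto elim!: uniformly_bounded_on_subset)
  then show ?thesis
    using n2 by (intro split[where A = UNIV and b = "- real n2"]) auto
qed

section \<open>Translation and reduction to multiplication by g\<close>

lemma HK_add: "h \<in> HK \<Longrightarrow> k \<in> HK \<Longrightarrow> (\<lambda>y. h y + k y) \<in> HK"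
  by (simp add: HK_def integrable_add)

lemma HK_diff: "h \<in> HK \<Longrightarrow> k \<in> HK \<Longrightarrow> (\<lambda>y. h y - k y) \<in> HK"
  by (simp add: HK_def integrable_diff)

lemma integral_translate: "integral {a..b} (\<lambda>y. h (y - x)) = integral {a - x..b - x} (h :: real \<Rightarrow> real)"
  using integral_shift_Icc_real[of a b h "-x"] by (simp add: comp_def)

lemma integrable_translate:
  "(\<lambda>y. h (y - x)) integrable_on {a..b} \<longleftrightarrow> (h :: real \<Rightarrow> real) integrable_on {a - x..b - x}"
  using integrable_on_shift_Icc_real[of h "-x" a b] by (simp add: comp_def)

lemma HK_translateI:
  assumes "h \<in> HK"
  shows "(\<lambda>y. h (y - x)) \<in> HK"
  unfolding HK_iff_Cauchy_tails integrable_translate integral_translate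
proof (intro conjI allI impI)
  show "h integrable_on {a - x..b - x}" for a b using assms HK_iff_Cauchy_tails by blast
  fix \<epsilon> :: real assume "\<epsilon> > 0"
  then obtain B where B: "\<And>u v. u \<le> v \<Longrightarrow> B \<le> u \<or> v \<le> - B \<Longrightarrow> \<bar>integral {u..v} h\<bar> \<le> \<epsilon>"
    using assms unfolding HK_iff_Cauchy_tails by meson
  have "\<bar>integral {u - x..v - x} h\<bar> \<le> \<epsilon>" if "u \<le> v" "B + \<bar>x\<bar> \<le> u \<or> v \<le> - (B + \<bar>x\<bar>)" for u v
    using that by (intro B) auto
  then show "\<exists>B. \<forall>u v. u \<le> v \<and> (B \<le> u \<or> v \<le> - B) \<longrightarrow> \<bar>integral {u - x..v - x} h\<bar> \<le> \<epsilon>" by blast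
qed

lemma HK_translate_iff: "(\<lambda>y. h (y - x)) \<in> HK \<longleftrightarrow> h \<in> HK"
  using HK_translateI[of h x] HK_translateI[of "\<lambda>y. h (y - x)" "- x"] by auto

lemma HK_translation_continuous:
  assumes "h \<in> HK" "\<epsilon> > 0"
  shows "\<forall>\<^sub>F x in at 0. \<forall>a b. \<bar>integral {a - x..b - x} h - integral {a..b} h\<bar> \<le> \<epsilon>"
proof -
  have int: "h integrable_on {a..b}" for a b using assms HK_iff_Cauchy_tails by blast
  obtain \<delta> where "\<delta> > 0" and \<delta>: "\<And>u v. u \<le> v \<Longrightarrow> v \<le> u + \<delta> \<Longrightarrow> \<bar>integral {u..v} h\<bar> \<le> \<epsilon> / 2"
    using HK_small_on_short_intervals[OF assms(1), of "\<epsilon>/2"] \<open>\<epsilon> > 0\<close> by auto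
  have "\<bar>integral {a - x..b - x} h - integral {a..b} h\<bar> \<le> \<epsilon>" if "\<bar>x\<bar> < \<delta>" for x a b
  proof (cases "a \<le> b")
    case True
    define F where "F y = integral {a - \<bar>x\<bar>..y} h" for y
    have F: "F u + integral {u..v} h = F v" if "a - \<bar>x\<bar> \<le> u" "u \<le> v" for u v
      unfolding F_def using that by (intro Henstock_Kurzweil_Integration.integral_combine int)
    have close: "\<bar>F (c - x) - F c\<bar> \<le> \<epsilon> / 2" if "a \<le> c" for c
    proof (cases "x \<le> 0")
      case True
      have "F c + integral {c..c - x} h = F (c - x)"
        using True \<open>a \<le> c\<close> by (intro F) auto
      moreover have "\<bar>integral {c..c - x} h\<bar> \<le> \<epsilon> / 2"
        using True \<open>\<bar>x\<bar> < \<delta>\<close> by (intro \<delta>) auto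
      ultimately show ?thesis by linarith
    next
      case False
      have "F (c - x) + integral {c - x..c} h = F c"
        using False \<open>a \<le> c\<close> by (intro F) auto
      moreover have "\<bar>integral {c - x..c} h\<bar> \<le> \<epsilon> / 2"
        using False \<open>\<bar>x\<bar> < \<delta>\<close> by (intro \<delta>) auto
      ultimately show ?thesis by linarith
    qed
    have "F a + integral {a..b} h = F b" "F (a - x) + integral {a - x..b - x} h = F (b - x)"
      using True by (auto intro!: F)
    then show ?thesis
      using close[of a] close[OF True] by linarith
  qed (use \<open>\<epsilon> > 0\<close> in simp)
  then show ?thesis
    unfolding eventually_at using \<open>\<delta> > 0\<close> by (intro exI[of _ \<delta>]) (auto simp: dist_real_def)
qed

text \<open>
  Up to a translation of the interval of integration, the function on the left has the integral of h (g_x - 1) plus the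
  translation error of h, and the latter tends to 0 uniformly in the interval.
\<close>

lemma alexiewicz_tendsto_0_translate_iff:
  assumes "h \<in> HK"
  shows "alexiewicz_tendsto_0 (\<lambda>x y. h (y - x) * g x (y - x) - h y) \<longleftrightarrow>
    (\<forall>\<^sub>F x in at 0. (\<lambda>y. h y * g x y) \<in> HK) \<and>
    (\<forall>\<epsilon>>0. \<forall>\<^sub>F x in at 0. \<forall>a b. \<bar>integral {a..b} (\<lambda>y. h y * (g x y - 1))\<bar> \<le> \<epsilon>)"
    (is "alexiewicz_tendsto_0 ?k \<longleftrightarrow> ?mem \<and> ?lim")
proof -
  have mem_iff: "?k x \<in> HK \<longleftrightarrow> (\<lambda>y. h y * g x y) \<in> HK" for x
  proof -
    have "?k x \<in> HK \<longleftrightarrow> (\<lambda>y. h (y - x) * g x (y - x)) \<in> HK"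
      using HK_add[OF _ assms, of "?k x"] HK_diff[OF _ assms, of "\<lambda>y. h (y - x) * g x (y - x)"] by auto
    then show ?thesis using HK_translate_iff[of "\<lambda>y. h y * g x y"] by simp
  qed
  have int: "h integrable_on {a..b}" for a b using assms HK_iff_Cauchy_tails by blast
  have k_eq: "integral {a..b} (?k x) = integral {a - x..b - x} (\<lambda>y. h y * (g x y - 1)) +
      (integral {a - x..b - x} h - integral {a..b} h)" if "(\<lambda>y. h y * g x y) \<in> HK" for x a b
  proof -
    have hg: "(\<lambda>y. h y * g x y) integrable_on {a..b}" for a b using that HK_iff_Cauchy_tails by blast
    have "(\<lambda>y. h (y - x) * g x (y - x)) integrable_on {a..b}"
      using integrable_translate[of "\<lambda>y. h y * g x y"] hg by simp
    then have "integral {a..b} (?k x) = integral {a..b} (\<lambda>y. h (y - x) * g x (y - x)) - integral {a..b} h"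
      by (intro integral_diff int)
    also have "integral {a..b} (\<lambda>y. h (y - x) * g x (y - x)) = integral {a - x..b - x} (\<lambda>y. h y * g x y)"
      by (rule integral_translate)
    also have "\<dots> = integral {a - x..b - x} (\<lambda>y. h y * (g x y - 1)) + integral {a - x..b - x} h"
      using integral_diff[OF hg int, of "a - x" "b - x"] by (simp add: right_diff_distrib)
    finally show ?thesis by simp
  qed
  have lim_iff: "(\<forall>\<epsilon>>0. \<forall>\<^sub>F x in at 0. \<forall>a b. \<bar>integral {a..b} (?k x)\<bar> \<le> \<epsilon>) \<longleftrightarrow> ?lim" if ?mem
  proof (intro iffI allI impI)
    fix \<epsilon> :: real
    assume L: "\<forall>\<epsilon>>0. \<forall>\<^sub>F x in at 0. \<forall>a b. \<bar>integral {a..b} (?k x)\<bar> \<le> \<epsilon>" and "\<epsilon> > 0"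
    then have "\<epsilon> / 2 > 0" by simp
    show "\<forall>\<^sub>F x in at 0. \<forall>a b. \<bar>integral {a..b} (\<lambda>y. h y * (g x y - 1))\<bar> \<le> \<epsilon>"
      using L[rule_format, OF \<open>\<epsilon> / 2 > 0\<close>] HK_translation_continuous[OF assms \<open>\<epsilon> / 2 > 0\<close>] \<open>?mem\<close>
    proof eventually_elim
      case (elim x)
      show ?case
      proof (intro allI)
        fix a b
        show "\<bar>integral {a..b} (\<lambda>y. h y * (g x y - 1))\<bar> \<le> \<epsilon>"
          using elim(1)[rule_format, of "a + x" "b + x"] elim(2)[rule_format, of "a + x" "b + x"]
            k_eq[OF elim(3), of "a + x" "b + x"]
          unfolding add_diff_cancel_right' by linarith
      qed
    qed
  next
    fix \<epsilon> :: real
    assume L: ?lim and "\<epsilon> > 0"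
    then have "\<epsilon> / 2 > 0" by simp
    show "\<forall>\<^sub>F x in at 0. \<forall>a b. \<bar>integral {a..b} (?k x)\<bar> \<le> \<epsilon>"
      using L[rule_format, OF \<open>\<epsilon> / 2 > 0\<close>] HK_translation_continuous[OF assms \<open>\<epsilon> / 2 > 0\<close>] \<open>?mem\<close>
    proof eventually_elim
      case (elim x)
      show ?case
      proof (intro allI)
        fix a b
        show "\<bar>integral {a..b} (?k x)\<bar> \<le> \<epsilon>"
          using elim(1)[rule_format, of "a - x" "b - x"] elim(2)[rule_format, of a b]
            k_eq[OF elim(3), of a b] by linarith
      qed
    qed
  qed
  show ?thesis
    unfolding alexiewicz_tendsto_0_iff mem_iff using lim_iff by blast
qed

section \<open>Level sets and integrals\<close>

lemma ess_mono_diff_const: "ess_mono_diff (\<lambda>_. c) \<bar>c\<bar>"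
  unfolding ess_mono_diff_def by (intro exI[of _ "\<lambda>_. c"] exI[of _ "\<lambda>_. 0"]) (simp add: mono_def)

lemma ess_mono_diff_mono: "ess_mono_diff \<phi> M \<Longrightarrow> M \<le> M' \<Longrightarrow> ess_mono_diff \<phi> M'"
  unfolding ess_mono_diff_def by (meson order_trans)

lemma ess_mono_diff_minus_one:
  assumes "ess_mono_diff \<phi> M"
  shows "ess_mono_diff (\<lambda>y. \<phi> y - 1) (M + 1)"
proof -
  obtain P N where PN: "mono P" "mono N" "\<And>y. \<bar>P y\<bar> \<le> M" "\<And>y. \<bar>N y\<bar> \<le> M"
    and ae: "AE y in lebesgue. \<phi> y = P y - N y"
    using assms unfolding ess_mono_diff_def by auto
  have "AE y in lebesgue. \<phi> y - 1 = P y - (N y + 1)" using ae by eventually_elim simp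
  moreover have "mono (\<lambda>y. N y + 1)" using PN(2) by (simp add: mono_def)
  moreover have "\<bar>P y\<bar> \<le> M + 1 \<and> \<bar>N y + 1\<bar> \<le> M + 1" for y using PN(3,4)[of y] by linarith
  ultimately show ?thesis
    unfolding ess_mono_diff_def using PN(1) by (intro exI[of _ P] exI[of _ "\<lambda>y. N y + 1"]) auto
qed

lemma ess_mono_diff_absolutely_integrable:
  assumes "ess_mono_diff \<phi> M"
  shows "\<phi> absolutely_integrable_on {a..b}"
proof -
  define \<psi> where "\<psi> y = (if \<bar>\<phi> y\<bar> \<le> 2 * M then \<phi> y else 0)" for y
  have "0 \<le> M" using assms unfolding ess_mono_diff_def by (metis abs_ge_zero order_trans)
  have "\<psi> \<in> borel_measurable lebesgue"
    unfolding \<psi>_def using ess_mono_diff_AE(1)[OF assms] by measurable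
  then have "\<psi> absolutely_integrable_on {a..b}"
    by (intro measurable_bounded_by_integrable_imp_absolutely_integrable[where g = "\<lambda>_. 2 * M"])
      (use \<open>0 \<le> M\<close> in \<open>auto simp: \<psi>_def intro: measurable_restrict_space1\<close>)
  moreover have "negligible {y. \<not> \<bar>\<phi> y\<bar> \<le> 2 * M}"
    using ess_mono_diff_AE(2)[OF assms] by (rule iffD1[OF AE_lebesgue_negligible])
  ultimately show ?thesis
    by (rule absolutely_integrable_spike) (simp add: \<psi>_def)
qed

lemma level_set_lmeasurable:
  assumes "\<phi> \<in> borel_measurable lebesgue"
  shows "{y \<in> {a..b::real}. \<bar>\<phi> y - 1\<bar> > (\<epsilon> :: real)} \<in> lmeasurable"
proof (rule fmeasurableI2[of "{a..b}"])
  have "{y \<in> space lebesgue. \<bar>\<phi> y - 1\<bar> > \<epsilon>} \<in> sets lebesgue" using assms by measurable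
  then have "{y. \<bar>\<phi> y - 1\<bar> > \<epsilon>} \<in> sets lebesgue" by simp
  then have "{a..b} \<inter> {y. \<bar>\<phi> y - 1\<bar> > \<epsilon>} \<in> sets lebesgue" by (intro sets.Int) auto
  then show "{y \<in> {a..b}. \<bar>\<phi> y - 1\<bar> > \<epsilon>} \<in> sets lebesgue" by (simp add: Int_def)
qed auto

text \<open>
  Outside the level set the integrand is at most \<open>\<epsilon>\<close>; on the level set the essential bound 2 (M + 1) is used.
\<close>

lemma integral_abs_le_level_set:
  assumes "ess_mono_diff \<phi> M" "a \<le> b" "0 \<le> \<epsilon>"
  shows "integral {a..b} (\<lambda>y. \<bar>\<phi> y - 1\<bar>) \<le>
     \<epsilon> * (b - a) + 2 * (M + 1) * measure lebesgue {y \<in> {a..b}. \<bar>\<phi> y - 1\<bar> > \<epsilon>}"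
proof -
  let ?S = "{y \<in> {a..b}. \<bar>\<phi> y - 1\<bar> > \<epsilon>}" and ?Z = "{y. \<not> \<bar>\<phi> y - 1\<bar> \<le> 2 * (M + 1)}"
  note u = ess_mono_diff_minus_one[OF assms(1)]
  have "0 \<le> M" using assms(1) unfolding ess_mono_diff_def by (metis abs_ge_zero order_trans)
  have S: "?S \<in> lmeasurable" using level_set_lmeasurable ess_mono_diff_AE(1)[OF assms(1)] by blast
  have "negligible ?Z" using ess_mono_diff_AE(2)[OF u] by (rule iffD1[OF AE_lebesgue_negligible])
  have u_int: "(\<lambda>y. \<bar>\<phi> y - 1\<bar>) integrable_on {a..b}"
    using ess_mono_diff_absolutely_integrable[OF u] by (simp add: absolutely_integrable_on_def)
  have "((\<lambda>y. 1::real) has_integral measure lebesgue ?S) ?S"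
    using S by (simp add: has_integral_iff lmeasurable_iff_integrable_on lmeasure_integral)
  then have "((\<lambda>y. if y \<in> ?S then 1 else 0::real) has_integral measure lebesgue ?S) {a..b}"
    by (subst has_integral_restrict) auto
  then have "((\<lambda>y. 2 * (M + 1) * (if y \<in> ?S then 1 else 0)) has_integral 2 * (M + 1) * measure lebesgue ?S) {a..b}"
    by (rule has_integral_mult_right)
  moreover have "((\<lambda>y. \<epsilon>) has_integral \<epsilon> * (b - a)) {a..b}"
    using has_integral_const_real[of \<epsilon> a b] \<open>a \<le> b\<close> by (simp add: mult.commute)
  ultimately have bound: "((\<lambda>y. \<epsilon> + 2 * (M + 1) * (if y \<in> ?S then 1 else 0)) has_integral
      \<epsilon> * (b - a) + 2 * (M + 1) * measure lebesgue ?S) {a..b}"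
    by (intro has_integral_add)
  have "integral {a..b} (\<lambda>y. \<bar>\<phi> y - 1\<bar>) = integral {a..b} (\<lambda>y. if y \<in> ?Z then 0 else \<bar>\<phi> y - 1\<bar>)"
    by (rule integral_spike[OF \<open>negligible ?Z\<close>]) auto
  also have "\<dots> \<le> integral {a..b} (\<lambda>y. \<epsilon> + 2 * (M + 1) * (if y \<in> ?S then 1 else 0))"
  proof (rule integral_le)
    show "(\<lambda>y. if y \<in> ?Z then 0 else \<bar>\<phi> y - 1\<bar>) integrable_on {a..b}"
      by (rule integrable_spike[OF u_int \<open>negligible ?Z\<close>]) auto
    show "(\<lambda>y. \<epsilon> + 2 * (M + 1) * (if y \<in> ?S then 1 else 0)) integrable_on {a..b}"
      using bound by blast
    fix y assume "y \<in> {a..b}"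
    then show "(if y \<in> ?Z then 0 else \<bar>\<phi> y - 1\<bar>) \<le> \<epsilon> + 2 * (M + 1) * (if y \<in> ?S then 1 else 0)"
      using \<open>0 \<le> \<epsilon>\<close> \<open>0 \<le> M\<close> by auto
  qed
  also have "\<dots> = \<epsilon> * (b - a) + 2 * (M + 1) * measure lebesgue ?S"
    using bound by (rule integral_unique)
  finally show ?thesis .
qed

text \<open>
  Chebyshev's inequality.
\<close>

lemma level_set_le_integral_square:
  assumes "ess_mono_diff \<phi> M" "0 < \<epsilon>"
    and int: "(\<lambda>y. (\<phi> y - 1) * (\<phi> y - 1)) integrable_on {a..b}"
  shows "\<epsilon>\<^sup>2 * measure lebesgue {y \<in> {a..b}. \<bar>\<phi> y - 1\<bar> > \<epsilon>}
    \<le> integral {a..b} (\<lambda>y. (\<phi> y - 1) * (\<phi> y - 1))"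
proof -
  let ?S = "{y \<in> {a..b}. \<bar>\<phi> y - 1\<bar> > \<epsilon>}"
  have S: "?S \<in> lmeasurable" using level_set_lmeasurable ess_mono_diff_AE(1)[OF assms(1)] by blast
  have "((\<lambda>y. 1::real) has_integral measure lebesgue ?S) ?S"
    using S by (simp add: has_integral_iff lmeasurable_iff_integrable_on lmeasure_integral)
  then have "((\<lambda>y. if y \<in> ?S then 1 else 0::real) has_integral measure lebesgue ?S) {a..b}"
    by (subst has_integral_restrict) auto
  then have "((\<lambda>y. \<epsilon>\<^sup>2 * (if y \<in> ?S then 1 else 0)) has_integral \<epsilon>\<^sup>2 * measure lebesgue ?S) {a..b}"
    by (rule has_integral_mult_right)
  then show ?thesis
  proof (rule has_integral_le[OF _ integrable_integral[OF int]])
    fix y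
    show "\<epsilon>\<^sup>2 * (if y \<in> ?S then 1 else 0) \<le> (\<phi> y - 1) * (\<phi> y - 1)"
    proof (cases "y \<in> ?S")
      case True
      then have "\<epsilon>\<^sup>2 \<le> \<bar>\<phi> y - 1\<bar>\<^sup>2" using \<open>0 < \<epsilon>\<close> by (intro power_mono) auto
      then show ?thesis using True by (simp add: power2_eq_square)
    qed auto
  qed
qed

lemma tendsto_0_emeasure_iff:
  assumes "\<forall>\<^sub>F x in F. S x \<in> fmeasurable M"
  shows "((\<lambda>x. emeasure M (S x)) \<longlongrightarrow> 0) F \<longleftrightarrow> ((\<lambda>x. measure M (S x)) \<longlongrightarrow> 0) F"
proof -
  have "((\<lambda>x. emeasure M (S x)) \<longlongrightarrow> 0) F \<longleftrightarrow> ((\<lambda>x. ennreal (measure M (S x))) \<longlongrightarrow> ennreal 0) F"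
    unfolding ennreal_0
    by (rule tendsto_cong) (use assms in \<open>auto elim!: eventually_mono simp: emeasure_eq_measure2\<close>)
  also have "\<dots> \<longleftrightarrow> ((\<lambda>x. measure M (S x)) \<longlongrightarrow> 0) F"
    by (rule tendsto_ennreal_iff) auto
  finally show ?thesis .
qed

section \<open>Both directions of the characterisation\<close>

text \<open>
  With h = (h - s) + s for a bounded s of bounded support close to h, the first summand is handled by the uniform multiplier
  bound and the second one by convergence of g_x to 1 in the mean on the support of s.
\<close>

lemma multiplier_convergence:
  fixes g :: "real \<Rightarrow> real \<Rightarrow> real"
  assumes "unif_ess_bounded_ess_bv g" "tendsto_1_in_measure_on_compacts g" "h \<in> HK"
  shows "\<forall>\<^sub>F x in at 0. (\<lambda>y. h y * g x y) \<in> HK"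
    and "\<epsilon> > 0 \<Longrightarrow> \<forall>\<^sub>F x in at 0. \<forall>a b. \<bar>integral {a..b} (\<lambda>y. h y * (g x y - 1))\<bar> \<le> \<epsilon>"
proof -
  obtain \<delta> M0 where "\<delta> > 0" and M0: "\<And>x. \<bar>x\<bar> < \<delta> \<Longrightarrow>
      esssup lebesgue (\<lambda>y. ereal \<bar>g x y\<bar>) \<le> ereal M0 \<and> essential_variation (g x) \<le> ereal M0"
    using assms(1) unfolding unif_ess_bounded_ess_bv_def by blast
  define M where "M = 3 * M0 + 2"
  have "ess_mono_diff (g x) M" if "\<bar>x\<bar> < \<delta>" for x
    unfolding M_def using M0[OF that] by (intro ess_mono_diffI) auto
  then have ev: "\<forall>\<^sub>F x in at 0. ess_mono_diff (g x) M"
    unfolding eventually_at using \<open>\<delta> > 0\<close> by (auto simp: dist_real_def)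
  then show mem: "\<forall>\<^sub>F x in at 0. (\<lambda>y. h y * g x y) \<in> HK"
    by eventually_elim (rule ess_mono_diff_multiplier_HK[OF assms(3)])
  have "0 \<le> M"
    using eventually_happens[OF ev] unfolding ess_mono_diff_def by (metis abs_ge_zero at_neq_bot order_trans)
  have int: "h integrable_on {a..b}" for a b using assms(3) HK_iff_Cauchy_tails by blast
  show "\<forall>\<^sub>F x in at 0. \<forall>a b. \<bar>integral {a..b} (\<lambda>y. h y * (g x y - 1))\<bar> \<le> \<epsilon>" if "\<epsilon> > 0"
  proof -
    \<comment> \<open>The monotone parts of g_x - 1 are bounded by M + 1, so the multiplier constant is 4 (M + 1), and h - s
    contributes at most half of the total error.\<close>
    define \<eta> where "\<eta> = \<epsilon> / (8 * (M + 1))"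
    have "\<eta> > 0" using \<open>\<epsilon> > 0\<close> \<open>0 \<le> M\<close> by (simp add: \<eta>_def)
    have \<eta>_eq: "4 * (M + 1) * \<eta> = \<epsilon> / 2"
    proof -
      have "4 * p * (\<epsilon> / (8 * p)) = \<epsilon> / 2" if "p \<noteq> 0" for p :: real using that by simp
      moreover have "M + 1 \<noteq> 0" using \<open>0 \<le> M\<close> by simp
      ultimately show ?thesis unfolding \<eta>_def by blast
    qed
    obtain s B C where "B \<ge> 0" and s_bound: "\<And>y. \<bar>s y\<bar> \<le> C" and s_supp: "\<And>y. B < \<bar>y\<bar> \<Longrightarrow> s y = 0"
      and s_int: "\<And>a b. s integrable_on {a..b}"
      and hs: "\<And>a b. \<bar>integral {a..b} (\<lambda>y. h y - s y)\<bar> \<le> \<eta>"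
      by (rule HK_approx_bounded[OF assms(3) \<open>\<eta> > 0\<close>]) (rule that)
    have "0 \<le> C" using s_bound[of 0] by linarith
    \<comment> \<open>Chosen so that an L1 error of 2 * \<kappa> * (B + 1) on [-B, B], multiplied by the bound C of s, is at most the other half.
    Replacing C and B by C + 1 and B + 1 avoids division by 0.\<close>
    define \<kappa> where "\<kappa> = \<epsilon> / (4 * ((C + 1) * (B + 1)))"
    have "\<kappa> > 0" using \<open>\<epsilon> > 0\<close> \<open>0 \<le> C\<close> \<open>0 \<le> B\<close> by (simp add: \<kappa>_def)
    let ?S = "\<lambda>x. {y \<in> {-B..B}. \<bar>g x y - 1\<bar> > \<kappa> / 2}"
    have "\<forall>\<^sub>F x in at 0. ?S x \<in> lmeasurable"
      using ev by eventually_elim (intro level_set_lmeasurable ess_mono_diff_AE)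
    moreover have "((\<lambda>x. emeasure lebesgue (?S x)) \<longlongrightarrow> 0) (at 0)"
      using assms(2) half_gt_zero[OF \<open>\<kappa> > 0\<close>] unfolding tendsto_1_in_measure_on_compacts_def by blast
    ultimately have "((\<lambda>x. measure lebesgue (?S x)) \<longlongrightarrow> 0) (at 0)"
      by (rule iffD1[OF tendsto_0_emeasure_iff])
    moreover have "\<kappa> * (B + 1) / (2 * (M + 1)) > 0"
      using \<open>\<kappa> > 0\<close> \<open>0 \<le> M\<close> \<open>0 \<le> B\<close> by simp
    ultimately have "\<forall>\<^sub>F x in at 0. measure lebesgue (?S x) < \<kappa> * (B + 1) / (2 * (M + 1))"
      by (rule order_tendstoD)
    then show ?thesis
      using ev mem
    proof eventually_elim
      case (elim x)
      let ?u = "\<lambda>y. g x y - 1"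
      note u = ess_mono_diff_minus_one[OF elim(2)]
      have L1: "integral {-B..B} (\<lambda>y. \<bar>?u y\<bar>) \<le> 2 * \<kappa> * (B + 1)"
      proof -
        have "2 * (M + 1) * measure lebesgue (?S x) \<le>
            2 * (M + 1) * (\<kappa> * (B + 1) / (2 * (M + 1)))"
          by (rule mult_left_mono[OF less_imp_le[OF elim(1)]]) (use \<open>0 \<le> M\<close> in simp)
        also have "2 * (M + 1) * (\<kappa> * (B + 1) / (2 * (M + 1))) = \<kappa> * (B + 1)"
        proof -
          have "2 * (M + 1) \<noteq> 0" using \<open>0 \<le> M\<close> by simp
          then show ?thesis
            unfolding times_divide_eq_right by (rule nonzero_mult_div_cancel_left)
        qed
        also have "\<dots> = \<kappa> * B + \<kappa>" by (simp add: distrib_left)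
        finally have "integral {-B..B} (\<lambda>y. \<bar>?u y\<bar>) \<le> \<kappa> / 2 * (B - (- B)) + (\<kappa> * B + \<kappa>)"
          using integral_abs_le_level_set[OF elim(2), of "-B" B "\<kappa>/2"] \<open>\<kappa> > 0\<close> \<open>0 \<le> B\<close> by linarith
        also have "\<dots> \<le> 2 * \<kappa> * (B + 1)" using \<open>\<kappa> > 0\<close> by (simp add: algebra_simps)
        finally show ?thesis .
      qed
      have u_int: "(\<lambda>y. \<bar>?u y\<bar>) integrable_on {a..b}" for a b
        using ess_mono_diff_absolutely_integrable[OF u] by (simp add: absolutely_integrable_on_def)
      show ?case
      proof (intro allI)
        fix a b
        have hs_int: "(\<lambda>y. h y - s y) integrable_on {a..b}" by (intro integrable_diff int s_int)
        note near = ess_mono_diff_multiplier[OF hs_int hs u]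
        have "(\<lambda>y. h y * g x y) integrable_on {a..b}" using elim(3) HK_iff_Cauchy_tails by blast
        then have hu_int: "(\<lambda>y. h y * ?u y) integrable_on {a..b}"
          using integrable_diff[OF _ int] by (simp add: right_diff_distrib)
        have su_int: "(\<lambda>y. s y * ?u y) integrable_on {a..b}"
          using integrable_diff[OF hu_int near(1)] by (simp add: algebra_simps)
        define D where "D y = (if y \<in> {-B..B} then C * \<bar>?u y\<bar> else 0)" for y
        have "((\<lambda>y. C * \<bar>?u y\<bar>) has_integral C * integral {-B..B} (\<lambda>y. \<bar>?u y\<bar>)) {-B..B}"
          by (intro has_integral_mult_right integrable_integral u_int)
        then have D_int: "(D has_integral C * integral {-B..B} (\<lambda>y. \<bar>?u y\<bar>)) UNIV"
          unfolding D_def by (simp only: has_integral_restrict_UNIV)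
        have "norm (integral {a..b} (\<lambda>y. s y * ?u y)) \<le> integral {a..b} D"
        proof (rule integral_norm_bound_integral[OF su_int])
          show "D integrable_on {a..b}" using D_int by (intro integrable_on_subinterval[of D UNIV]) auto
          fix y
          show "norm (s y * ?u y) \<le> D y"
            using s_supp[of y] mult_right_mono[OF s_bound[of y], of "\<bar>?u y\<bar>"]
            by (cases "B < \<bar>y\<bar>") (auto simp: D_def abs_mult)
        qed
        also have "\<dots> \<le> integral UNIV D"
          using D_int \<open>0 \<le> C\<close> by (intro integral_subset_le integrable_on_subinterval[of D UNIV]) (auto simp: D_def)
        also have "\<dots> \<le> C * (2 * \<kappa> * (B + 1))"
          unfolding integral_unique[OF D_int] using L1 \<open>0 \<le> C\<close> by (rule mult_left_mono)
        also have "\<dots> \<le> (C + 1) * (2 * \<kappa> * (B + 1))"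
          using \<open>\<kappa> > 0\<close> \<open>0 \<le> B\<close> by (intro mult_right_mono) auto
        also have "\<dots> = 2 * (((C + 1) * (B + 1)) * \<kappa>)" by (simp only: mult_ac)
        also have "((C + 1) * (B + 1)) * \<kappa> = \<epsilon> / 4"
        proof -
          have "p * (\<epsilon> / (4 * p)) = \<epsilon> / 4" if "p \<noteq> 0" for p :: real using that by simp
          moreover have "(C + 1) * (B + 1) \<noteq> 0" using \<open>0 \<le> C\<close> \<open>0 \<le> B\<close> by simp
          ultimately show ?thesis unfolding \<kappa>_def by blast
        qed
        finally have "\<bar>integral {a..b} (\<lambda>y. s y * ?u y)\<bar> \<le> \<epsilon> / 2" by simp
        moreover have "\<bar>integral {a..b} (\<lambda>y. (h y - s y) * ?u y)\<bar> \<le> \<epsilon> / 2"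
          using near(2) unfolding \<eta>_eq .
        moreover have "integral {a..b} (\<lambda>y. h y * ?u y) =
            integral {a..b} (\<lambda>y. (h y - s y) * ?u y) + integral {a..b} (\<lambda>y. s y * ?u y)"
          using integral_add[OF near(1) su_int] by (simp add: algebra_simps)
        ultimately show "\<bar>integral {a..b} (\<lambda>y. h y * ?u y)\<bar> \<le> \<epsilon>" by linarith
      qed
    qed
  qed
qed

lemma HK_inverse_one_plus_square: "(\<lambda>y. inverse (1 + y\<^sup>2)) \<in> HK"
proof -
  have int: "((\<lambda>y. inverse (1 + y\<^sup>2)) has_integral arctan b - arctan a) {a..b}" if "a \<le> b" for a b
    by (rule fundamental_theorem_of_calculus[OF that])
      (auto intro!: DERIV_arctan has_field_derivative_at_within
        simp flip: has_real_derivative_iff_has_vector_derivative)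
  have "\<exists>B. \<forall>u v. u \<le> v \<and> (B \<le> u \<or> v \<le> - B) \<longrightarrow> \<bar>integral {u..v} (\<lambda>y. inverse (1 + y\<^sup>2))\<bar> \<le> \<epsilon>"
    if "\<epsilon> > 0" for \<epsilon> :: real
  proof -
    have "\<forall>\<^sub>F y in at_top. pi / 2 - \<epsilon> < arctan y"
      using tendsto_arctan_at_top \<open>\<epsilon> > 0\<close> by (intro order_tendstoD) auto
    then obtain B where B: "\<And>y. B \<le> y \<Longrightarrow> pi / 2 - \<epsilon> < arctan y"
      unfolding eventually_at_top_linorder by blast
    have "\<bar>arctan v - arctan u\<bar> \<le> \<epsilon>" if "u \<le> v" "B \<le> u \<or> v \<le> - B" for u v
      using that(2)
    proof
      assume "B \<le> u"
      then show ?thesis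
        using B[of u] arctan_ubound[of v] that(1) arctan_monotone'[of u v] by linarith
    next
      assume "v \<le> - B"
      then show ?thesis
        using B[of "- v"] arctan_lbound[of u] that(1) arctan_monotone'[of u v] by (simp add: arctan_minus)
    qed
    then have "\<bar>integral {u..v} (\<lambda>y. inverse (1 + y\<^sup>2))\<bar> \<le> \<epsilon>" if "u \<le> v" "B \<le> u \<or> v \<le> - B" for u v
      using integral_unique[OF int] that by metis
    then show ?thesis by blast
  qed
  moreover have "(\<lambda>y. inverse (1 + y\<^sup>2)) integrable_on {a..b}" for a b :: real
    using int[of a b] by (cases "a \<le> b") (auto simp: integrable_on_empty)
  ultimately show ?thesis unfolding HK_iff_Cauchy_tails by blast
qed

text \<open>
  A nonnegative function is absolutely integrable as soon as it is integrable, so a single strictly positive h in HK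
  gives the local absolute integrability of g_x, and with it its measurability.
\<close>

lemma multiplier_locally_absolutely_integrable:
  assumes "(\<lambda>y. inverse (1 + y\<^sup>2) * \<phi> y) \<in> HK" "\<And>y. 0 \<le> \<phi> y"
  shows "\<phi> absolutely_integrable_on {a..b :: real}"
proof -
  have "(\<lambda>y. inverse (1 + y\<^sup>2) * \<phi> y) integrable_on {a..b}"
    using assms(1) HK_iff_Cauchy_tails by blast
  then have int: "(\<lambda>y. inverse (1 + y\<^sup>2) * \<phi> y) absolutely_integrable_on {a..b}"
    by (rule nonnegative_absolutely_integrable_1) (use assms(2) in simp)
  have cont: "continuous_on {a..b} (\<lambda>y. 1 + y\<^sup>2)" by (intro continuous_intros)
  have "(\<lambda>y. (1 + y\<^sup>2) * (inverse (1 + y\<^sup>2) * \<phi> y)) absolutely_integrable_on {a..b}"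
  proof (rule absolutely_integrable_bounded_measurable_product_real[OF _ _ _ int])
    show "(\<lambda>y. 1 + y\<^sup>2) \<in> borel_measurable (lebesgue_on {a..b})"
      using cont by (rule continuous_imp_measurable_on_sets_lebesgue) auto
    show "bounded ((\<lambda>y. 1 + y\<^sup>2) ` {a..b})"
      using cont by (intro compact_imp_bounded compact_continuous_image) auto
  qed auto
  moreover have "(1 + y\<^sup>2) * (inverse (1 + y\<^sup>2) * \<phi> y) = \<phi> y" for y
  proof -
    have "1 + y\<^sup>2 \<noteq> 0" by (smt (verit) zero_le_power2)
    then show ?thesis by simp
  qed
  ultimately show ?thesis by simp
qed

text \<open>
  The range of x for which h g_x is in HK depends on h. The function 1 / (1 + y^2) provides one range in which g_x is locally
  absolutely integrable; from there on all pairings are with test functions. For the convergence in measure,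
  u = g_x - 1 serves as the integrand, with small norm on [a, b], and at the same time as the multiplier, with bounded variation.
\<close>

lemma ess_bounded_ess_bv_if_multiplier_convergence:
  fixes g :: "real \<Rightarrow> real \<Rightarrow> real"
  assumes nonneg: "\<And>x y. 0 \<le> g x y" and g0: "\<And>y. g 0 y = 1"
    and mem: "\<And>h. h \<in> HK \<Longrightarrow> \<forall>\<^sub>F x in at 0. (\<lambda>y. h y * g x y) \<in> HK"
    and lim: "\<And>h \<epsilon>. h \<in> HK \<Longrightarrow> \<epsilon> > 0 \<Longrightarrow>
      \<forall>\<^sub>F x in at 0. \<forall>a b. \<bar>integral {a..b} (\<lambda>y. h y * (g x y - 1))\<bar> \<le> \<epsilon>"
  shows "unif_ess_bounded_ess_bv g" "tendsto_1_in_measure_on_compacts g"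
proof -
  obtain \<delta>0 where "\<delta>0 > 0"
    and \<delta>0: "\<And>x. x \<noteq> 0 \<Longrightarrow> \<bar>x\<bar> < \<delta>0 \<Longrightarrow> (\<lambda>y. inverse (1 + y\<^sup>2) * g x y) \<in> HK"
    using mem[OF HK_inverse_one_plus_square] unfolding eventually_at by (auto simp: dist_real_def)
  have int: "g x absolutely_integrable_on {a..b}" if "x \<noteq> 0" "\<bar>x\<bar> < \<delta>0" for x a b
    using multiplier_locally_absolutely_integrable[OF \<delta>0[OF that] nonneg] .
  have "uniformly_bounded_on g UNIV"
    by (rule uniformly_bounded_on_UNIV[OF lim[OF _ zero_less_one] \<open>\<delta>0 > 0\<close> int])
  then obtain \<delta>1 K where "\<delta>1 > 0" and K: "\<And>x s. x \<noteq> 0 \<Longrightarrow> \<bar>x\<bar> < \<delta>1 \<Longrightarrow> test_function UNIV s \<Longrightarrow>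
      \<bar>integral UNIV (\<lambda>y. s y * g x y)\<bar> \<le> K"
    unfolding uniformly_bounded_on_def by metis
  define \<delta> where "\<delta> = min \<delta>0 \<delta>1"
  define M where "M = max 1 (3 * K)"
  have "\<delta> > 0" using \<open>\<delta>0 > 0\<close> \<open>\<delta>1 > 0\<close> by (simp add: \<delta>_def)
  have bv: "ess_mono_diff (g x) M" if "\<bar>x\<bar> < \<delta>" for x
  proof (cases "x = 0")
    case True
    then have "g x = (\<lambda>_. 1)" using g0 by auto
    then show ?thesis
      using ess_mono_diff_mono[OF ess_mono_diff_const[of 1], of M] by (simp add: M_def)
  next
    case False
    have "g x integrable_on {a..b}" for a b
      using int[OF False] that by (simp add: \<delta>_def absolutely_integrable_on_def)
    then have "ess_mono_diff (g x) (3 * K)"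
      using K[OF False] that by (intro ess_mono_diff_by_duality) (auto simp: \<delta>_def)
    then show ?thesis by (rule ess_mono_diff_mono) (simp add: M_def)
  qed
  then show "unif_ess_bounded_ess_bv g"
    unfolding unif_ess_bounded_ess_bv_def using \<open>\<delta> > 0\<close> ess_mono_diffD by blast
  have ev: "\<forall>\<^sub>F x in at 0. ess_mono_diff (g x) M"
    unfolding eventually_at using \<open>\<delta> > 0\<close> bv by (auto simp: dist_real_def)
  have "0 < M" by (simp add: M_def)
  show "tendsto_1_in_measure_on_compacts g"
    unfolding tendsto_1_in_measure_on_compacts_def
  proof (intro allI impI)
    fix a b \<epsilon> :: real assume "\<epsilon> > 0"
    let ?S = "\<lambda>x. {y \<in> {a..b}. \<bar>g x y - 1\<bar> > \<epsilon>}"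
    have "\<forall>\<^sub>F x in at 0. ?S x \<in> lmeasurable"
      using ev by eventually_elim (intro level_set_lmeasurable ess_mono_diff_AE)
    moreover have "((\<lambda>x. measure lebesgue (?S x)) \<longlongrightarrow> 0) (at 0)"
    proof (rule tendstoI)
      fix e :: real assume "e > 0"
      define \<eta> where "\<eta> = \<epsilon>\<^sup>2 * e / (8 * (M + 1))"
      have "\<eta> > 0" using \<open>\<epsilon> > 0\<close> \<open>e > 0\<close> \<open>0 < M\<close> by (simp add: \<eta>_def)
      define h where "h y = (if y \<in> {a..b} then 1 else 0 :: real)" for y
      have "h \<in> HK" unfolding h_def HK_def mem_Collect_eq integrable_restrict_UNIV by (rule integrable_const_ivl)
      show "\<forall>\<^sub>F x in at 0. dist (measure lebesgue (?S x)) 0 < e"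
        using lim[OF \<open>h \<in> HK\<close> \<open>\<eta> > 0\<close>] ev
      proof eventually_elim
        case (elim x)
        let ?u = "\<lambda>y. g x y - 1"
        note u = ess_mono_diff_minus_one[OF elim(2)]
        have u_int: "?u integrable_on {a..b}"
          using ess_mono_diff_absolutely_integrable[OF u] by (simp add: absolutely_integrable_on_def)
        have small: "\<bar>integral {c..d} ?u\<bar> \<le> \<eta>" if "a \<le> c" "d \<le> b" for c d
        proof -
          have "integral {c..d} (\<lambda>y. h y * ?u y) = integral {c..d} ?u"
            by (rule integral_cong) (use that in \<open>auto simp: h_def\<close>)
          then show ?thesis using elim(1) by metis
        qed
        note sq = ess_mono_diff_multiplier[OF u_int small u]
        have "\<epsilon>\<^sup>2 * measure lebesgue (?S x) \<le> integral {a..b} (\<lambda>y. ?u y * ?u y)"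
          by (rule level_set_le_integral_square[OF elim(2) \<open>\<epsilon> > 0\<close> sq(1)])
        also have "\<dots> \<le> 4 * (M + 1) * \<eta>" using sq(2) by linarith
        also have "\<dots> = \<epsilon>\<^sup>2 * (e / 2)" using \<open>0 < M\<close> by (simp add: \<eta>_def field_simps)
        finally have "measure lebesgue (?S x) \<le> e / 2" using \<open>\<epsilon> > 0\<close> by (simp add: mult_le_cancel_left_pos)
        then show ?case using \<open>e > 0\<close> by (simp add: dist_real_def)
      qed
    qed
    ultimately show "((\<lambda>x. emeasure lebesgue (?S x)) \<longlongrightarrow> 0) (at 0)"
      by (rule iffD2[OF tendsto_0_emeasure_iff])
  qed
qed

theorem theorem7:
  fixes w :: "real \<Rightarrow> real" and g :: "real \<Rightarrow> real \<Rightarrow> real"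
  assumes w_pos: "\<And>y. w y > 0"
    and g_def: "\<And>x y. g x y = w (y + x) / w y"
  shows "(\<forall>f :: real \<Rightarrow> real. (\<lambda>y. f y * w y) \<in> HK \<longrightarrow>
            alexiewicz_tendsto_0 (\<lambda>x y. (translate x f y - f y) * w y))
         \<longleftrightarrow> unif_ess_bounded_ess_bv g \<and> tendsto_1_in_measure_on_compacts g"
    (is "?L \<longleftrightarrow> ?R")
proof -
  have w: "w y \<noteq> 0" for y using w_pos[of y] by simp
  have rewrite: "(\<lambda>x y. (translate x f y - f y) * w y) =
      (\<lambda>x y. (f (y - x) * w (y - x)) * g x (y - x) - f y * w y)" for f
    by (intro ext) (simp add: translate_def g_def w left_diff_distrib)
  note iff = alexiewicz_tendsto_0_translate_iff[of "\<lambda>y. f y * w y" g for f, folded rewrite]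
  show ?thesis
  proof
    assume L: ?L
    \<comment> \<open>Every h in HK arises as f w, with f = h / w.\<close>
    have conv: "(\<forall>\<^sub>F x in at 0. (\<lambda>y. h y * g x y) \<in> HK) \<and>
      (\<forall>\<epsilon>>0. \<forall>\<^sub>F x in at 0. \<forall>a b. \<bar>integral {a..b} (\<lambda>y. h y * (g x y - 1))\<bar> \<le> \<epsilon>)"
      if "h \<in> HK" for h
    proof -
      have h: "(\<lambda>y. h y / w y * w y) = h" using w by auto
      have "alexiewicz_tendsto_0 (\<lambda>x y. (translate x (\<lambda>y. h y / w y) y - h y / w y) * w y)"
        using L[rule_format, of "\<lambda>y. h y / w y"] that by (simp only: h)
      then show ?thesis
        using iff[of "\<lambda>y. h y / w y"] that unfolding h by (simp add: w)
    qed
    have nonneg: "0 \<le> g x y" for x y using w_pos[of y] w_pos[of "y + x"] by (simp add: g_def)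
    have g0: "g 0 y = 1" for y by (simp add: g_def w)
    show ?R
      using ess_bounded_ess_bv_if_multiplier_convergence[of g, OF nonneg g0] conv by blast
  next
    assume ?R
    then show ?L
      using iff multiplier_convergence by blast
  qed
qed

end
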